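(* Suppose that $\tilde X$ comes from a recurrent birth and death process on $\mathbb Z^+$, that is, $X$ is recurrent on $S=\mathbb Z^+$ and $q_{i,j}=0$ whenever $i\in C=\mathbb N$, $j\in S$ and $|i-j|>1$. If, for some $i\in\mathbb N$, $\tau_0^{(i)}$ is subexponential, then for all $j\in\mathbb N$ $$\mathbb P(\tau_0^{(j)}>t)\sim\frac{\beta_j}{\beta_i}\,\mathbb P(\tau_0^{(i)}>t)\quad\text{as } t\to\infty,$$ where $\beta$ is the unique $\tilde P$-harmonic function on $\mathbb N$ with $\beta_1=1$.
   Context: $X=(X_t)_{t\ge0}$ is an irreducible, non-explosive continuous-time Markov chain on $S=\mathbb Z^+=\{0,1,2,\dots\}$ with $Q$-matrix $(q_{i,j})$; $C=S\setminus\{0\}=\mathbb N$. $\tilde X$ is $X$ killed on first hitting $0$, assumed irreducible on $C$, with substochastic semigroup $(\tilde P(t))_{t\ge0}$ on $C$. $\tau_0^{(i)}$ is a random variable distributed as the first hitting time of $0$ by $X$ started from $i$. A nonnegative function $\beta$ on $\mathbb N$ is $\tilde P$-harmonic if $\tilde P(t)\beta=\beta$ for all $t\ge0$. A random variable $Z\ge 0$ with distribution function $F_Z$ is subexponential if $\overline{F_Z^{n}}(t)/\overline{F_Z}(t)\to n$ as $t\to\infty$ for all $n$, where $F_Z^{n}$ is the $n$-fold convolution of $F_Z$ and $\overline G=1-G$. *)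

theory Defs
  imports "HOL-Probability.Probability" "HOL-Library.Landau_Symbols"
begin

section \<open>Continuous-time Markov chains on the natural numbers\<close>

definition Q_matrix :: "(nat \<Rightarrow> nat \<Rightarrow> real) \<Rightarrow> bool" where
  "Q_matrix q \<longleftrightarrow> (\<forall>i j. i \<noteq> j \<longrightarrow> 0 \<le> q i j) \<and> (\<forall>i. (q i has_sum 0) UNIV)"

text \<open>
  The chain is a Markov family: \<open>P i\<close> is the law under which it starts from \<open>i\<close>, all on one
  measurable space, with \<open>X t \<omega>\<close> the position at time \<open>t \<ge> 0\<close> (values at negative \<open>t\<close> play no role).
  The transition function is \<open>p\<^sub>i\<^sub>j(t) = P\<^sub>i(X\<^sub>t = j)\<close>; the Markov property is the elementary,
  time-homogeneous one for finite-dimensional distributions, and \<open>q\<close> is the derivative of \<open>p\<close> at 0.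
\<close>

locale markov_chain =
  fixes P :: "nat \<Rightarrow> 'a measure" and X :: "real \<Rightarrow> 'a \<Rightarrow> nat" and q :: "nat \<Rightarrow> nat \<Rightarrow> real"
  assumes prob_space_P: "\<And>i. prob_space (P i)"
    and sets_P: "\<And>i j. sets (P i) = sets (P j)"
    and measurable_X: "\<And>i t. 0 \<le> t \<Longrightarrow> X t \<in> measurable (P i) (count_space UNIV)"
    and right_continuous_X:
      "\<And>i \<omega> t. \<omega> \<in> space (P i) \<Longrightarrow> 0 \<le> t \<Longrightarrow> eventually (\<lambda>s. X s \<omega> = X t \<omega>) (at_right t)"
    and start: "\<And>i. AE \<omega> in P i. X 0 \<omega> = i"
    and markov: "\<And>i n t x. 0 \<le> t 0 \<Longrightarrow> (\<forall>k\<le>n. t k \<le> t (Suc k)) \<Longrightarrow>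
      measure (P i) {\<omega> \<in> space (P i). \<forall>k\<le>Suc n. X (t k) \<omega> = x k} =
      measure (P i) {\<omega> \<in> space (P i). \<forall>k\<le>n. X (t k) \<omega> = x k} *
      measure (P (x n)) {\<omega> \<in> space (P (x n)). X (t (Suc n) - t n) \<omega> = x (Suc n)}"
    and Q_matrix_q: "Q_matrix q"
    and derivative_at_0: "\<And>i j. ((\<lambda>t. measure (P i) {\<omega> \<in> space (P i). X t \<omega> = j})
      has_real_derivative q i j) (at 0 within {0..})"

definition irreducible_chain :: "(nat \<Rightarrow> 'a measure) \<Rightarrow> (real \<Rightarrow> 'a \<Rightarrow> nat) \<Rightarrow> bool" where
  "irreducible_chain P X \<longleftrightarrow>
    (\<forall>i j. \<exists>t>0. 0 < measure (P i) {\<omega> \<in> space (P i). X t \<omega> = j})"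

text \<open>
  Non-explosion: almost surely, only finitely many jumps in bounded time. For a right-continuous
  path in a discrete space the jump times are the points of left discontinuity.
\<close>

definition jump_times :: "(real \<Rightarrow> 'a \<Rightarrow> nat) \<Rightarrow> 'a \<Rightarrow> real set" where
  "jump_times X \<omega> = {t. 0 < t \<and> \<not> eventually (\<lambda>s. X s \<omega> = X t \<omega>) (at_left t)}"

definition non_explosive :: "(nat \<Rightarrow> 'a measure) \<Rightarrow> (real \<Rightarrow> 'a \<Rightarrow> nat) \<Rightarrow> bool" where
  "non_explosive P X \<longleftrightarrow> (\<forall>i. AE \<omega> in P i. \<forall>T. finite (jump_times X \<omega> \<inter> {..T}))"

definition recurrent :: "(nat \<Rightarrow> 'a measure) \<Rightarrow> (real \<Rightarrow> 'a \<Rightarrow> nat) \<Rightarrow> bool" where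
  "recurrent P X \<longleftrightarrow> (\<forall>i. AE \<omega> in P i. \<not> bdd_above {t. 0 \<le> t \<and> X t \<omega> = i})"

section \<open>The chain killed at 0\<close>

definition hitting_time_0 :: "(real \<Rightarrow> 'a \<Rightarrow> nat) \<Rightarrow> 'a \<Rightarrow> ennreal" where
  "hitting_time_0 X \<omega> = Inf {ennreal t | t. 0 \<le> t \<and> X t \<omega> = 0}"

definition hitting_tail :: "(nat \<Rightarrow> 'a measure) \<Rightarrow> (real \<Rightarrow> 'a \<Rightarrow> nat) \<Rightarrow> nat \<Rightarrow> real \<Rightarrow> real" where
  "hitting_tail P X i t = measure (P i) {\<omega> \<in> space (P i). ennreal t < hitting_time_0 X \<omega>}"

definition killed_transition ::
  "(nat \<Rightarrow> 'a measure) \<Rightarrow> (real \<Rightarrow> 'a \<Rightarrow> nat) \<Rightarrow> real \<Rightarrow> nat \<Rightarrow> nat \<Rightarrow> real" where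
  "killed_transition P X t i j =
    measure (P i) {\<omega> \<in> space (P i). X t \<omega> = j \<and> ennreal t < hitting_time_0 X \<omega>}"

definition killed_irreducible :: "(nat \<Rightarrow> 'a measure) \<Rightarrow> (real \<Rightarrow> 'a \<Rightarrow> nat) \<Rightarrow> bool" where
  "killed_irreducible P X \<longleftrightarrow> (\<forall>i\<ge>1. \<forall>j\<ge>1. \<exists>t>0. 0 < killed_transition P X t i j)"

text \<open>Functions on \<open>{1, 2, \<dots>}\<close> are represented by functions on \<open>nat\<close> whose value at 0 is ignored.\<close>

definition killed_harmonic ::
  "(nat \<Rightarrow> 'a measure) \<Rightarrow> (real \<Rightarrow> 'a \<Rightarrow> nat) \<Rightarrow> (nat \<Rightarrow> real) \<Rightarrow> bool" where
  "killed_harmonic P X \<beta> \<longleftrightarrow> (\<forall>i\<ge>1. 0 \<le> \<beta> i) \<and>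
    (\<forall>t\<ge>0. \<forall>i\<ge>1. ((\<lambda>j. killed_transition P X t i j * \<beta> j) has_sum \<beta> i) {1..})"

section \<open>Subexponential random variables\<close>

primrec convolution_power :: "real measure \<Rightarrow> nat \<Rightarrow> real measure" where
  "convolution_power \<mu> 0 = return borel 0"
| "convolution_power \<mu> (Suc n) = convolution \<mu> (convolution_power \<mu> n)"

text \<open>
  The variable takes values in \<open>[0, \<infinity>]\<close> so that hitting times qualify; it must be almost surely
  finite. No positivity of the tail is required separately: the case \<open>n = 1\<close> of the limit
  forces it, since \<open>x / 0 = 0\<close>.
\<close>

definition subexponential :: "'a measure \<Rightarrow> ('a \<Rightarrow> ennreal) \<Rightarrow> bool" where
  "subexponential M Z \<longleftrightarrow> Z \<in> borel_measurable M \<and> (AE \<omega> in M. Z \<omega> < \<infinity>) \<and>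
    (let \<mu> = distr M borel (\<lambda>\<omega>. enn2real (Z \<omega>)) in
      \<forall>n\<ge>1. ((\<lambda>t. (1 - cdf (convolution_power \<mu> n) t) / (1 - cdf \<mu> t)) \<longlongrightarrow> real n) at_top)"

end

theory Submission
  imports Defs
begin

text \<open>
  Write \<open>h\<^sub>j(t)\<close> for the probability that the chain started in \<open>j\<close> survives beyond \<open>t\<close>. The killed
  semigroup satisfies the backward equation, so \<open>h\<^sub>j' = (Qh)\<^sub>j\<close> on \<open>\<nat>\<close> with \<open>h\<^sub>0 = 0\<close>.
  Subexponentiality enters only through long-tailedness, \<open>h\<^sub>i(t + a) \<sim> h\<^sub>i(t)\<close>. By irreducibility
  a decrement of \<open>h\<^sub>j\<close> is bounded by a constant times a later decrement of \<open>h\<^sub>i\<close>, so all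
  decrements are \<open>o(h\<^sub>i)\<close> and \<open>r\<^sub>j = h\<^sub>j / h\<^sub>i\<close> satisfies \<open>(Qr)\<^sub>j \<rightarrow> 0\<close>. For a birth and death chain
  the equation \<open>Q\<beta> = 0\<close>, \<open>\<beta>\<^sub>0 = 0\<close> is a two-term recursion for the differences of \<open>\<beta>\<close>, whence
  \<open>r\<^sub>j \<rightarrow> \<beta>\<^sub>j / \<beta>\<^sub>i\<close>. Since \<open>Qh \<le> 0\<close>, the ratio \<open>h\<^sub>j / \<beta>\<^sub>j\<close> is nonincreasing in \<open>j\<close>; this dominates
  \<open>r\<^sub>j\<close> and allows passing to the limit in \<open>h(s + t) = P(s) h(t)\<close>, which proves that \<open>\<beta>\<close> is harmonic.
\<close>

section \<open>Subexponential distributions are long-tailed\<close>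

text \<open>The Markov property is assumed only at finitely many deterministic times, while killing
  depends on a continuum of times and the hitting time is random. This shapes the construction of
  the killed semigroup: avoiding 0 on an interval is a decreasing limit of avoiding 0 on dyadic
  grids, by right continuity, and the semigroup law and the derivative at time 0 are obtained from
  statements on each grid that survive refinement. Irreducibility of the killed chain is also what
  makes every birth rate strictly positive, so that the recursion for \<beta> can be solved upwards.
  Long tails control decrements over time intervals, whereas \<open>Qh\<close> is an instantaneous
  derivative; the mean value theorem bridges the two. Uniqueness of \<beta> meets another obstacle:
  an identity between infinite sums cannot be differentiated term by term, so the backward equation
  is integrated for truncated sums before the limit is taken.\<close>

lemma prob_space_convolution:
  fixes M N :: "real measure"
  assumes "prob_space M" "prob_space N" and [measurable_cong]: "sets M = sets borel" "sets N = sets borel"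
  shows "prob_space (M \<star> N)"
proof -
  interpret M: prob_space M by fact
  interpret N: prob_space N by fact
  interpret pair_prob_space M N ..
  show ?thesis unfolding convolution_def by (intro prob_space_distr) measurable
qed

text \<open>Condition on the value \<open>x\<close> of one summand: on \<open>{0..y}\<close>,
  \<open>{y<..t}\<close> and \<open>{t<..}\<close> the probability
  \<open>measure \<mu> {t - x<..}\<close> that the other summand completes the excess is at least
  the tail at \<open>t\<close>, the tail at \<open>t - y\<close>, and 1. The middle range brings in
  the tail at the earlier time, which is the quantity that long-tailedness has to bound.\<close>

lemma convolution_square_tail:
  assumes "real_distribution \<mu>" and nonneg: "measure \<mu> {0..} = 1" and "0 \<le> y" "y \<le> t"
  shows "measure \<mu> {t<..} + measure \<mu> {0..y} * measure \<mu> {t<..} + measure \<mu> {y<..t} * measure \<mu> {t - y<..} \<le>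
    measure (convolution_power \<mu> 2) {t<..}"
proof -
  interpret real_distribution \<mu> by fact
  have fin: "finite_measure \<mu>" "finite_measure (return borel (0::real))"
    using finite_measure_axioms prob_space_return[of 0 borel] by (auto intro: prob_space.finite_measure)
  have fin2: "finite_measure (\<mu> \<star> return borel 0)"
    by (rule convolution_finite) (use fin in auto)
  have fin3: "finite_measure (\<mu> \<star> (\<mu> \<star> return borel 0))"
    by (rule convolution_finite) (use fin fin2 in auto)
  let ?e = "\<lambda>A. ennreal (measure \<mu> A)"
  have ge: "?e {t<..} * indicator {0..y} x + ?e {t - y<..} * indicator {y<..t} x + 1 * indicator {t<..} x \<le> ?e {t - x<..}"
    if "x \<ge> 0" for x
  proof -
    consider "x \<le> y" | "y < x" "x \<le> t" | "t < x" by linarith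
    thus ?thesis
    proof cases
      case 1
      have "?e {t<..} \<le> ?e {t - x<..}" using that by (intro ennreal_leI finite_measure_mono) auto
      thus ?thesis using 1 that \<open>y \<le> t\<close> by simp
    next
      case 2
      have "?e {t - y<..} \<le> ?e {t - x<..}" using 2 by (intro ennreal_leI finite_measure_mono) auto
      thus ?thesis using 2 by simp
    next
      case 3
      have "measure \<mu> {0..} \<le> measure \<mu> {t - x<..}" using 3 by (intro finite_measure_mono) auto
      hence "1 \<le> ?e {t - x<..}" using nonneg by simp
      thus ?thesis using 3 \<open>y \<le> t\<close> by simp
    qed
  qed
  have ae: "AE x in \<mu>. x \<ge> 0"
    using nonneg AE_in_set_eq_1[of "{0..}"] by simp
  have "?e {t<..} * emeasure \<mu> {0..y} + ?e {t - y<..} * emeasure \<mu> {y<..t} + 1 * emeasure \<mu> {t<..} =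
    (\<integral>\<^sup>+x. ?e {t<..} * indicator {0..y} x + ?e {t - y<..} * indicator {y<..t} x + 1 * indicator {t<..} x \<partial>\<mu>)"
    by (simp add: nn_integral_add nn_integral_cmult_indicator)
  also have "\<dots> \<le> (\<integral>\<^sup>+x. ?e {t - x<..} \<partial>\<mu>)"
    by (rule nn_integral_mono_AE, rule AE_mp[OF ae], rule AE_I2) (use ge in blast)
  \<comment> \<open>\<open>convolution_power\<close> ends in the point mass at 0, so the square is a
    triple convolution whose innermost integral is evaluation at 0.\<close>
  also have "\<dots> = (\<integral>\<^sup>+x. \<integral>\<^sup>+y. \<integral>\<^sup>+z. indicator {t<..} (x + y + z) \<partial>return borel 0 \<partial>\<mu> \<partial>\<mu>)"
  proof (rule nn_integral_cong)
    fix x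
    have "(\<integral>\<^sup>+y. \<integral>\<^sup>+z. indicator {t<..} (x + y + z) \<partial>return borel 0 \<partial>\<mu>) = (\<integral>\<^sup>+y. indicator {t - x<..} y \<partial>\<mu>)"
    proof (rule nn_integral_cong)
      fix y
      have "(\<integral>\<^sup>+z. indicator {t<..} (x + y + z) \<partial>return borel 0) = (indicator {t<..} (x + y + 0) :: ennreal)"
        by (rule nn_integral_return) auto
      thus "(\<integral>\<^sup>+z. indicator {t<..} (x + y + z) \<partial>return borel 0) = (indicator {t - x<..} y :: ennreal)"
        by (simp add: indicator_def algebra_simps)
    qed
    also have "\<dots> = ?e {t - x<..}" by (simp add: emeasure_eq_measure)
    finally show "?e {t - x<..} = (\<integral>\<^sup>+y. \<integral>\<^sup>+z. indicator {t<..} (x + y + z) \<partial>return borel 0 \<partial>\<mu>)" ..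
  qed
  also have "\<dots> = emeasure (\<mu> \<star> (\<mu> \<star> return borel 0)) {t<..}"
    by (rule convolution_emeasure_3[symmetric]) (use fin in auto)
  also have "\<dots> = ennreal (measure (convolution_power \<mu> 2) {t<..})"
    using fin3 by (simp add: numeral_2_eq_2 finite_measure.emeasure_eq_measure)
  finally show ?thesis
    by (simp add: emeasure_eq_measure algebra_simps flip: ennreal_mult ennreal_plus)
qed

text \<open>With \<open>y = a\<close>, dividing \<open>convolution_square_tail\<close> by the tail
  \<open>G t\<close> bounds \<open>G (t - a) / G t\<close> by
  \<open>(R t - 1 - (1 - G a)) / (G a - G t)\<close>. As \<open>R t\<close> tends to 2 and
  \<open>G t\<close> to 0, this tends to \<open>G a / G a = 1\<close>; monotonicity of the tail
  gives the lower bound 1.\<close>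

lemma subexponential_long_tailed:
  fixes Z :: "'a \<Rightarrow> ennreal"
  assumes "prob_space M" and sub: "subexponential M Z"
  defines "T \<equiv> \<lambda>t. measure M {\<omega> \<in> space M. ennreal t < Z \<omega>}"
  shows "\<And>t. 0 \<le> t \<Longrightarrow> 0 < T t" "\<And>a. 0 \<le> a \<Longrightarrow> ((\<lambda>t. T (t + a) / T t) \<longlongrightarrow> 1) at_top"
proof -
  interpret M: prob_space M by fact
  have Z [measurable]: "Z \<in> borel_measurable M" and fin: "AE \<omega> in M. Z \<omega> < \<infinity>"
    using sub by (auto simp: subexponential_def)
  define \<mu> where "\<mu> = distr M borel (\<lambda>\<omega>. enn2real (Z \<omega>))"
  interpret real_distribution \<mu>
    unfolding \<mu>_def by (intro M.real_distribution_distr) measurable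
  define G where "G t = measure \<mu> {t<..}" for t
  have GT: "G t = T t" if "0 \<le> t" for t
  proof -
    have "G t = measure M {\<omega> \<in> space M. t < enn2real (Z \<omega>)}"
      unfolding G_def \<mu>_def by (subst measure_distr) (auto intro!: arg_cong[of _ _ "measure M"])
    also have "\<dots> = T t"
      unfolding T_def
    proof (rule M.finite_measure_eq_AE)
      show "AE \<omega> in M. (\<omega> \<in> {\<omega> \<in> space M. t < enn2real (Z \<omega>)}) = (\<omega> \<in> {\<omega> \<in> space M. ennreal t < Z \<omega>})"
        using fin
      proof eventually_elim
        case (elim \<omega>)
        then obtain z where "Z \<omega> = ennreal z" "z \<ge> 0" by (cases "Z \<omega>") auto
        thus ?case using that by (simp add: ennreal_less_iff)
      qed
    qed measurable
    finally show ?thesis .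
  qed
  have cdfG: "1 - cdf \<mu> t = G t" for t
    unfolding cdf_def G_def using prob_compl[of "{..t}"] by (simp add: Compl_eq_Diff_UNIV[symmetric])
  have nonneg: "measure \<mu> {0..} = 1"
  proof -
    have "(\<lambda>\<omega>. enn2real (Z \<omega>)) -` {0..} \<inter> space M = space M" by auto
    thus ?thesis unfolding \<mu>_def by (subst measure_distr) (auto simp: M.prob_space)
  qed
  have Gmono: "G t \<le> G s" if "s \<le> t" for s t
    unfolding G_def using that by (intro finite_measure_mono) auto
  have lim: "((\<lambda>t. (1 - cdf (convolution_power \<mu> n) t) / G t) \<longlongrightarrow> real n) at_top" if "n \<ge> 1" for n
    using sub that unfolding subexponential_def \<mu>_def[symmetric] Let_def cdfG by blast
  have Gpos: "0 < G t" for t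
  proof -
    have "eventually (\<lambda>t. (1 - cdf (convolution_power \<mu> 1) t) / G t > 0) at_top"
      using lim[of 1] by (intro order_tendstoD(1)) auto
    with eventually_ge_at_top[of t] have "eventually (\<lambda>u. G u \<noteq> 0 \<and> u \<ge> t) at_top"
      by eventually_elim auto
    then obtain u where "G u \<noteq> 0" "u \<ge> t" unfolding eventually_at_top_linorder by blast
    moreover have "0 \<le> G u" by (simp add: G_def)
    ultimately show ?thesis using Gmono[of t u] by linarith
  qed
  show "0 < T t" if "0 \<le> t" for t using Gpos[of t] GT[OF that] by simp
  have "((\<lambda>t. 1 - cdf \<mu> t) \<longlongrightarrow> 1 - 1) at_top"
    by (intro tendsto_diff tendsto_const cdf_lim_at_top_prob)
  hence G0: "(G \<longlongrightarrow> 0) at_top" unfolding cdfG by simp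
  define R where "R t = (1 - cdf (convolution_power \<mu> 2) t) / G t" for t
  have R: "(R \<longlongrightarrow> 2) at_top" using lim[of 2] unfolding R_def by simp
  have fin2: "prob_space (convolution_power \<mu> 2)"
    unfolding numeral_2_eq_2 convolution_power.simps
    by (intro prob_space_convolution prob_space_axioms prob_space_return) auto
  show "((\<lambda>t. T (t + a) / T t) \<longlongrightarrow> 1) at_top" if "0 \<le> a" for a
  proof -
    have "((\<lambda>t. (R t - 1 - (1 - G a)) / (G a - G t)) \<longlongrightarrow> (2 - 1 - (1 - G a)) / (G a - 0)) at_top"
      using Gpos[of a] by (intro tendsto_intros R G0) auto
    hence up: "((\<lambda>t. (R t - 1 - (1 - G a)) / (G a - G t)) \<longlongrightarrow> 1) at_top" using Gpos[of a] by simp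
    have "((\<lambda>t. G (t - a) / G t) \<longlongrightarrow> 1) at_top"
    proof (rule tendsto_sandwich[OF _ _ tendsto_const up])
      show "\<forall>\<^sub>F t in at_top. 1 \<le> G (t - a) / G t"
        using Gmono[of "t - a" t for t] Gpos that by (auto simp: field_simps)
      have "\<forall>\<^sub>F t in at_top. G t < G a" using order_tendstoD(2)[OF G0 Gpos[of a]] .
      with eventually_ge_at_top[of a]
      show "\<forall>\<^sub>F t in at_top. G (t - a) / G t \<le> (R t - 1 - (1 - G a)) / (G a - G t)"
      proof eventually_elim
        case (elim t)
        have "measure \<mu> {0..a} = 1 - G a"
        proof -
          have "{0..} = {0..a} \<union> {a<..}" using that by auto
          moreover have "measure \<mu> ({0..a} \<union> {a<..}) = measure \<mu> {0..a} + measure \<mu> {a<..}"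
            by (intro finite_measure_Union) auto
          ultimately show ?thesis using nonneg by (simp add: G_def)
        qed
        moreover have "measure \<mu> {a<..t} = G a - G t"
        proof -
          have "{a<..} = {a<..t} \<union> {t<..}" using elim by auto
          moreover have "measure \<mu> ({a<..t} \<union> {t<..}) = measure \<mu> {a<..t} + measure \<mu> {t<..}"
            by (intro finite_measure_Union) auto
          ultimately show ?thesis by (simp add: G_def)
        qed
        moreover have "measure (convolution_power \<mu> 2) {t<..} = R t * G t"
        proof -
          interpret c: prob_space "convolution_power \<mu> 2" by (rule fin2)
          have "sets (convolution_power \<mu> 2) = sets borel" by (simp add: numeral_2_eq_2)
          moreover have "space (convolution_power \<mu> 2) = UNIV" by (simp add: numeral_2_eq_2)
          ultimately have "measure (convolution_power \<mu> 2) {t<..} = 1 - cdf (convolution_power \<mu> 2) t"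
            unfolding cdf_def using c.prob_compl[of "{..t}"] by (simp add: Compl_eq_Diff_UNIV[symmetric])
          thus ?thesis using Gpos[of t] by (simp add: R_def)
        qed
        ultimately have "G t + (1 - G a) * G t + (G a - G t) * G (t - a) \<le> R t * G t"
          using convolution_square_tail[OF real_distribution_axioms nonneg that elim(1)] by (simp add: G_def)
        hence "(G a - G t) * G (t - a) \<le> (R t - 1 - (1 - G a)) * G t" by (simp add: algebra_simps)
        thus ?case using elim(2) Gpos[of t] by (simp add: field_simps)
      qed
    qed
    hence "((\<lambda>t. G (t + a - a) / G (t + a)) \<longlongrightarrow> 1) at_top"
      by (rule filterlim_compose) (rule filterlim_tendsto_add_at_top[OF tendsto_const filterlim_ident, of a, simplified add.commute])
    from tendsto_inverse[OF this] have "((\<lambda>t. G (t + a) / G t) \<longlongrightarrow> 1) at_top" by simp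
    thus ?thesis
    proof (rule Lim_transform_eventually)
      show "\<forall>\<^sub>F t in at_top. G (t + a) / G t = T (t + a) / T t"
        using eventually_ge_at_top[of 0] by eventually_elim (use GT that in auto)
    qed
  qed
qed

section \<open>The killed semigroup\<close>

(* The simproc diverges on goals about sets of the form {\<omega> \<in> space (P i). \<forall>k\<le>n. X (t k) \<omega> \<in> A k}. *)
declare [[simproc del: measurable]]

text \<open>Right continuity freezes \<open>f\<close> at \<open>c\<close> just after a time
  \<open>u < b\<close> with \<open>f u = c\<close>, and a fine enough grid has a point there; the
  time \<open>b\<close> lies on every grid. A condition on a continuum of times thus becomes a
  countable one, which yields both measurability and limits.\<close>

lemma dyadic_detects_value:
  fixes f :: "real \<Rightarrow> nat"
  assumes rc: "\<And>u. a \<le> u \<Longrightarrow> eventually (\<lambda>s. f s = f u) (at_right u)" and "a \<le> b"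
  shows "(\<forall>u\<in>{a..b}. f u \<noteq> c) \<longleftrightarrow> (\<forall>n. \<forall>k\<le>2^n. f (a + (b - a) * real k / 2^n) \<noteq> c)"
proof
  assume L: "\<forall>u\<in>{a..b}. f u \<noteq> c"
  show "\<forall>n. \<forall>k\<le>2^n. f (a + (b - a) * real k / 2^n) \<noteq> c"
  proof (intro allI impI)
    fix n k :: nat assume k: "k \<le> 2^n"
    have "real k \<le> 2^n" using k by (metis of_nat_le_iff of_nat_numeral of_nat_power)
    hence "(b - a) * (real k / 2^n) \<le> (b - a) * 1"
      by (intro mult_left_mono) (use \<open>a \<le> b\<close> in auto)
    moreover have "0 \<le> (b - a) * (real k / 2^n)" using \<open>a \<le> b\<close> by simp
    ultimately have "a + (b - a) * real k / 2^n \<in> {a..b}" by simp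
    thus "f (a + (b - a) * real k / 2^n) \<noteq> c" using L by blast
  qed
next
  assume R: "\<forall>n. \<forall>k\<le>2^n. f (a + (b - a) * real k / 2^n) \<noteq> c"
  show "\<forall>u\<in>{a..b}. f u \<noteq> c"
  proof (rule ballI, rule notI)
    fix u assume u: "u \<in> {a..b}" and c: "f u = c"
    show False
    proof (cases "u = b")
      case True
      thus False using R[rule_format, of 1 0] c by simp
    next
      case False
      hence "u < b" using u by auto
      from rc[of u] u obtain d where d: "d > u" "\<And>s. u < s \<Longrightarrow> s < d \<Longrightarrow> f s = c"
        unfolding eventually_at_right_field using c by auto
      define v where "v = min d b"
      have v: "u < v" "v \<le> b" "v \<le> d" using d \<open>u < b\<close> by (auto simp: v_def)
      have ba: "b - a > 0" using \<open>u < b\<close> u by auto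
      obtain n where n: "(b - a) / (v - u) < 2^n"
        using real_arch_pow[of 2 "(b - a) / (v - u)"] by auto
      hence n': "(b - a) / 2^n < v - u" using v(1)
        by (simp add: field_simps)
      \<comment> \<open>\<open>x\<close> is the position of \<open>u\<close> in units of the mesh
        and \<open>k\<close> the first index strictly beyond it, so grid point \<open>k\<close> lies
        after \<open>u\<close> by at most one mesh, hence before \<open>v\<close>. As
        \<open>v \<le> b\<close>, the index \<open>k\<close> stays within the grid.\<close>
      define x where "x = (u - a) * 2^n / (b - a)"
      have x0: "x \<ge> 0" using u ba by (simp add: x_def)
      define k where "k = nat \<lfloor>x\<rfloor> + 1"
      have k1: "x < real k" "real k \<le> x + 1" using x0 by (auto simp: k_def) linarith+
      have e: "a + (b - a) * x / 2^n = u" using ba by (simp add: x_def)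
      have g1: "u < a + (b - a) * real k / 2^n"
        using k1(1) ba by (subst e[symmetric]) (simp add: divide_strict_right_mono)
      have "a + (b - a) * real k / 2^n \<le> a + (b - a) * (x + 1) / 2^n"
        using k1(2) ba by (simp add: divide_right_mono)
      also have "\<dots> = u + (b - a) / 2^n" using e by (simp add: field_simps)
      also have "\<dots> < v" using n' by simp
      finally have g2: "a + (b - a) * real k / 2^n < v" .
      have "(b - a) * (real k / 2^n) < (b - a) * 1" using g2 v(2) by simp
      hence "real k / 2^n < 1" using ba by (simp only: mult_less_cancel_left_pos)
      hence "real k < 2^n" by (simp add: field_simps)
      hence "k \<le> 2^n" by (metis less_imp_le of_nat_less_iff of_nat_numeral of_nat_power)
      hence "f (a + (b - a) * real k / 2^n) \<noteq> c" using R by blast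
      thus False using d(2)[OF g1] g2 v(3) by simp
    qed
  qed
qed

lemma dyadic_mono:
  fixes f :: "real \<Rightarrow> nat"
  assumes "\<forall>k\<le>2^Suc n. f (a + d * real k / 2^Suc n) \<noteq> c" "k \<le> 2^n"
  shows "f (a + d * real k / 2^n) \<noteq> c"
proof -
  have "f (a + d * real (2 * k) / 2^Suc n) \<noteq> c" using assms by (intro assms(1)[rule_format]) auto
  thus ?thesis by (simp add: field_simps)
qed

context markov_chain
begin

section \<open>The Markov property for products of sets of states\<close>

abbreviation "prb i A \<equiv> measure (P i) {\<omega> \<in> space (P i). A \<omega>}"

lemma X_set:
  "0 \<le> t \<Longrightarrow> {\<omega> \<in> space (P i). X t \<omega> \<in> K} \<in> sets (P i)"
  using measurable_sets[OF measurable_X[of t i], of K] by (simp add: vimage_def Int_def conj_commute)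

lemma all_X_set:
  assumes "\<And>k::nat. 0 \<le> t k"
  shows "{\<omega> \<in> space (P i). \<forall>k\<le>n. X (t k) \<omega> \<in> A k} \<in> sets (P i)"
proof -
  have "{\<omega> \<in> space (P i). \<forall>k\<in>{..n}. X (t k) \<omega> \<in> A k} \<in> sets (P i)"
    by (rule sets.sets_Collect_finite_All) (simp_all add: X_set assms)
  thus ?thesis unfolding Ball_def atMost_iff .
qed

lemma prb_X0: "prb i (\<lambda>\<omega>. X 0 \<omega> = i) = 1"
proof -
  interpret prob_space "P i" by (rule prob_space_P)
  have "{\<omega> \<in> space (P i). X 0 \<omega> = i} \<in> events" using X_set[of 0 i "{i}"] by simp
  thus ?thesis using start[of i] by (simp add: prob_Collect_eq_1)
qed

text \<open>Induction on the second block: the one-step property under \<open>P j\<close> and under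
  \<open>P (x n)\<close> splits off the same last factor, because that factor depends only on
  \<open>x (n+m)\<close> and a time increment.\<close>

lemma fdd_block:
  assumes "0 \<le> t 0" and mono: "\<And>k. t k \<le> t (Suc k)"
  shows "prb j (\<lambda>\<omega>. \<forall>k\<le>n+m. X (t k) \<omega> = x k) =
    prb j (\<lambda>\<omega>. \<forall>k\<le>n. X (t k) \<omega> = x k) * prb (x n) (\<lambda>\<omega>. \<forall>k\<le>m. X (t (n+k) - t n) \<omega> = x (n+k))"
proof (induction m)
  case 0
  show ?case using prb_X0[of "x n"] by simp
next
  case (Suc m)
  have "prb j (\<lambda>\<omega>. \<forall>k\<le>Suc (n+m). X (t k) \<omega> = x k) = prb j (\<lambda>\<omega>. \<forall>k\<le>n+m. X (t k) \<omega> = x k)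
     * prb (x (n+m)) (\<lambda>\<omega>. X (t (Suc (n+m)) - t (n+m)) \<omega> = x (Suc (n+m)))"
    using assms by (intro markov) auto
  moreover have "prb (x n) (\<lambda>\<omega>. \<forall>k\<le>Suc m. X (t (n+k) - t n) \<omega> = x (n+k)) =
     prb (x n) (\<lambda>\<omega>. \<forall>k\<le>m. X (t (n+k) - t n) \<omega> = x (n+k)) *
     prb (x (n+m)) (\<lambda>\<omega>. X ((t (n+Suc m) - t n) - (t (n+m) - t n)) \<omega> = x (n+Suc m))"
    using mono by (intro markov[where t = "\<lambda>k. t (n+k) - t n" and x = "\<lambda>k. x (n+k)"]) auto
  ultimately show ?case using Suc.IH by simp
qed

lemma prb_coordinate_sums:
  assumes t0: "\<And>k::nat. 0 \<le> t k" and r: "r \<le> n"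
  shows "(\<lambda>z. prb j (\<lambda>\<omega>. \<forall>k\<le>n. X (t k) \<omega> \<in> (A(r := A r \<inter> {z})) k)) sums
    prb j (\<lambda>\<omega>. \<forall>k\<le>n. X (t k) \<omega> \<in> A k)"
proof -
  interpret prob_space "P j" by (rule prob_space_P)
  let ?E = "\<lambda>z. {\<omega> \<in> space (P j). \<forall>k\<le>n. X (t k) \<omega> \<in> (A(r := A r \<inter> {z})) k}"
  have "(\<lambda>z. prob (?E z)) sums prob (\<Union>z. ?E z)"
  proof (rule finite_measure_UNION)
    show "range ?E \<subseteq> events" using all_X_set[where t = t and n = n and i = j, OF t0] by blast
    show "disjoint_family ?E"
      unfolding disjoint_family_on_def using r by (auto dest!: spec[of _ r])
  qed
  also have "(\<Union>z. ?E z) = {\<omega> \<in> space (P j). \<forall>k\<le>n. X (t k) \<omega> \<in> A k}"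
  proof (intro equalityI subsetI)
    fix \<omega> assume "\<omega> \<in> (\<Union>z. ?E z)"
    then obtain z where "\<omega> \<in> ?E z" by blast
    hence "\<omega> \<in> space (P j)" "\<And>k. k \<le> n \<Longrightarrow> X (t k) \<omega> \<in> (A(r := A r \<inter> {z})) k"
      by blast+
    thus "\<omega> \<in> {\<omega> \<in> space (P j). \<forall>k\<le>n. X (t k) \<omega> \<in> A k}"
      by (simp add: fun_upd_def split: if_splits) (metis IntD1)
  next
    fix \<omega> assume "\<omega> \<in> {\<omega> \<in> space (P j). \<forall>k\<le>n. X (t k) \<omega> \<in> A k}"
    hence "\<omega> \<in> ?E (X (t r) \<omega>)" by simp
    thus "\<omega> \<in> (\<Union>z. ?E z)" by blast
  qed
  finally show ?thesis .
qed

text \<open>Pinning the state at index \<open>n\<close> to \<open>y\<close> fixes the law of the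
  future whatever happened before, so the remaining coordinates on both sides may be constrained by
  arbitrary sets.\<close>

lemma block_markov:
  assumes t0: "0 \<le> t 0" and mono: "\<And>k. t k \<le> t (Suc k)" and "A n = {y}"
  shows "prb j (\<lambda>\<omega>. \<forall>k\<le>n+m. X (t k) \<omega> \<in> A k) =
    prb j (\<lambda>\<omega>. \<forall>k\<le>n. X (t k) \<omega> \<in> A k) * prb y (\<lambda>\<omega>. \<forall>k\<le>m. X (t (n+k) - t n) \<omega> \<in> A (n+k))"
proof -
  have lm: "t k \<le> t l" if "k \<le> l" for k l using lift_Suc_mono_le[of t, OF mono that] .
  have tp: "0 \<le> t k" for k using t0 lm[of 0 k] by simp
  have "prb j (\<lambda>\<omega>. \<forall>k\<le>n+m. X (t k) \<omega> \<in> A k) =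
    prb j (\<lambda>\<omega>. \<forall>k\<le>n. X (t k) \<omega> \<in> A k) * prb y (\<lambda>\<omega>. \<forall>k\<le>m. X (t (n+k) - t n) \<omega> \<in> A (n+k))"
    \<comment> \<open>free the singleton coordinates one by one, by countable additivity\<close>
    if "\<And>k. k \<ge> r \<Longrightarrow> k \<le> n+m \<Longrightarrow> \<exists>z. A k \<subseteq> {z}" "A n = {y}" for r A
    using that
  proof (induction r arbitrary: A)
    case 0
    show ?case
    proof (cases "\<forall>k\<le>n+m. \<exists>z. A k = {z}")
      case True
      then obtain x where x: "\<And>k. k \<le> n+m \<Longrightarrow> A k = {x k}" by metis
      have "x n = y" using x[of n] 0 by simp
      have e: "(\<forall>k\<le>n+m. X (t k) \<omega> \<in> A k) = (\<forall>k\<le>n+m. X (t k) \<omega> = x k)"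
        "(\<forall>k\<le>n. X (t k) \<omega> \<in> A k) = (\<forall>k\<le>n. X (t k) \<omega> = x k)"
        "(\<forall>k\<le>m. X (t (n+k) - t n) \<omega> \<in> A (n+k)) = (\<forall>k\<le>m. X (t (n+k) - t n) \<omega> = x (n+k))" for \<omega>
        using x by auto
      show ?thesis unfolding e using fdd_block[OF t0 mono, of j n m x] \<open>x n = y\<close> by simp
    next
      case False
      then obtain k where k: "k \<le> n+m" "A k = {}" using 0(1) by (metis subset_singletonD zero_le)
      have "prb j (\<lambda>\<omega>. \<forall>k\<le>n+m. X (t k) \<omega> \<in> A k) = prb j (\<lambda>_. False)"
        using k by (intro arg_cong[of _ _ "measure (P j)"]) auto
      moreover have "prb j (\<lambda>\<omega>. \<forall>k\<le>n. X (t k) \<omega> \<in> A k) = 0 \<or>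
        prb y (\<lambda>\<omega>. \<forall>k\<le>m. X (t (n+k) - t n) \<omega> \<in> A (n+k)) = 0"
      proof (cases "k \<le> n")
        case True
        hence "{\<omega> \<in> space (P j). \<forall>k\<le>n. X (t k) \<omega> \<in> A k} = {}" using k by auto
        thus ?thesis by (metis measure_empty)
      next
        case False
        hence "n + (k - n) = k" "k - n \<le> m" using k by auto
        hence "{\<omega> \<in> space (P y). \<forall>k\<le>m. X (t (n+k) - t n) \<omega> \<in> A (n+k)} = {}"
          using k(2) by (metis (mono_tags, lifting) Collect_empty_eq empty_iff)
        thus ?thesis by (metis measure_empty)
      qed
      ultimately show ?thesis by auto
    qed
  next
    case (Suc r)
    show ?case
    proof (cases "r > n + m \<or> r = n")
      case True
      show ?thesis
      proof (rule Suc.IH)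
        show "\<exists>z. A k \<subseteq> {z}" if "r \<le> k" "k \<le> n + m" for k
          using Suc.prems(1)[of k] Suc.prems(2) True that by (cases "k = r") auto
      qed (use Suc.prems in auto)
    next
      case False
      let ?A = "\<lambda>z. A(r := A r \<inter> {z})"
      have IH: "prb j (\<lambda>\<omega>. \<forall>k\<le>n+m. X (t k) \<omega> \<in> ?A z k) =
        prb j (\<lambda>\<omega>. \<forall>k\<le>n. X (t k) \<omega> \<in> ?A z k) *
        prb y (\<lambda>\<omega>. \<forall>k\<le>m. X (t (n+k) - t n) \<omega> \<in> ?A z (n+k))" for z
      proof (rule Suc.IH)
        show "\<exists>w. ?A z k \<subseteq> {w}" if "r \<le> k" "k \<le> n + m" for k
          using Suc.prems(1)[of k] that by (cases "k = r") auto
      qed (use Suc.prems False in auto)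
      have S: "(\<lambda>z. prb j (\<lambda>\<omega>. \<forall>k\<le>n+m. X (t k) \<omega> \<in> ?A z k)) sums
          prb j (\<lambda>\<omega>. \<forall>k\<le>n+m. X (t k) \<omega> \<in> A k)"
        using False by (intro prb_coordinate_sums tp) auto
      \<comment> \<open>As \<open>r \<noteq> n\<close>, the index \<open>r\<close> belongs to
        exactly one of the two blocks; only that factor varies with \<open>z\<close>, so the series
        is a constant multiple of a coordinate sum.\<close>
      have "(\<lambda>z. prb j (\<lambda>\<omega>. \<forall>k\<le>n. X (t k) \<omega> \<in> ?A z k) *
          prb y (\<lambda>\<omega>. \<forall>k\<le>m. X (t (n+k) - t n) \<omega> \<in> ?A z (n+k))) sums
         (prb j (\<lambda>\<omega>. \<forall>k\<le>n. X (t k) \<omega> \<in> A k) * prb y (\<lambda>\<omega>. \<forall>k\<le>m. X (t (n+k) - t n) \<omega> \<in> A (n+k)))"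
      proof (cases "r < n")
        case True
        have "(\<lambda>z. prb j (\<lambda>\<omega>. \<forall>k\<le>n. X (t k) \<omega> \<in> ?A z k)) sums
            prb j (\<lambda>\<omega>. \<forall>k\<le>n. X (t k) \<omega> \<in> A k)"
          using True by (intro prb_coordinate_sums tp) auto
        from sums_mult2[OF this] True show ?thesis by simp
      next
        case F: False
        define s where "s = r - n"
        have s: "r = n + s" "s \<le> m" "s > 0" using F False by (auto simp: s_def)
        have "(\<lambda>z. prb y (\<lambda>\<omega>. \<forall>k\<le>m. X (t (n+k) - t n) \<omega> \<in> ((\<lambda>k. A (n+k))(s := A (n+s) \<inter> {z})) k)) sums
            prb y (\<lambda>\<omega>. \<forall>k\<le>m. X (t (n+k) - t n) \<omega> \<in> A (n+k))"
          using s lm by (intro prb_coordinate_sums[where A = "\<lambda>k. A (n+k)"]) auto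
        from sums_mult[OF this] have T: "(\<lambda>z. prb j (\<lambda>\<omega>. \<forall>k\<le>n. X (t k) \<omega> \<in> A k) * prb y (\<lambda>\<omega>. \<forall>k\<le>m. X (t (n+k) - t n) \<omega> \<in> ((\<lambda>k. A (n+k))(s := A (n+s) \<inter> {z})) k)) sums
            (prb j (\<lambda>\<omega>. \<forall>k\<le>n. X (t k) \<omega> \<in> A k) * prb y (\<lambda>\<omega>. \<forall>k\<le>m. X (t (n+k) - t n) \<omega> \<in> A (n+k)))" .
        have e1: "(\<lambda>k. A (n+k))(s := A (n+s) \<inter> {z}) = (\<lambda>k. ?A z (n+k))" for z
          by (rule ext) (use s in auto)
        have e2: "(\<forall>k\<le>n. X (t k) \<omega> \<in> ?A z k) = (\<forall>k\<le>n. X (t k) \<omega> \<in> A k)" for \<omega> z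
          using s by auto
        show ?thesis using T unfolding e1 e2 .
      qed
      with S show ?thesis unfolding IH by (rule sums_unique2)
    qed
  qed
  from this[of "Suc (n+m)" A] assms(3) show ?thesis by auto
qed

section \<open>Killing seen through dyadic grids\<close>

definition alive :: "real \<Rightarrow> real \<Rightarrow> nat \<Rightarrow> 'a \<Rightarrow> bool" where
  "alive a b n \<omega> \<longleftrightarrow> (\<forall>k\<le>2^n. X (a + (b - a) * real k / 2^n) \<omega> \<noteq> 0)"

text \<open>The set \<open>K\<close> covers transition probabilities (\<open>K = {k}\<close>) and
  survival probabilities (\<open>K = UNIV\<close>) at once. The starting state comes last, so that
  \<open>killed K t\<close> is a function on states to which the generator can be applied.\<close>

definition killed :: "nat set \<Rightarrow> real \<Rightarrow> nat \<Rightarrow> real" where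
  "killed K t j = prb j (\<lambda>\<omega>. X t \<omega> \<in> K \<and> ennreal t < hitting_time_0 X \<omega>)"

text \<open>The strict inequality comes from right continuity: a path that is nonzero at
  \<open>t\<close> stays nonzero up to some \<open>d > t\<close>, so the infimum is at least
  \<open>d\<close>.\<close>

lemma hitting_time_gt_iff:
  assumes \<omega>: "\<omega> \<in> space (P i)" and "0 \<le> t"
  shows "ennreal t < hitting_time_0 X \<omega> \<longleftrightarrow> (\<forall>u\<in>{0..t}. X u \<omega> \<noteq> 0)"
proof
  assume L: "ennreal t < hitting_time_0 X \<omega>"
  show "\<forall>u\<in>{0..t}. X u \<omega> \<noteq> 0"
  proof (rule ballI, rule notI)
    fix u assume u: "u \<in> {0..t}" "X u \<omega> = 0"
    have "hitting_time_0 X \<omega> \<le> ennreal u"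
      unfolding hitting_time_0_def using u by (intro Inf_lower) auto
    also have "\<dots> \<le> ennreal t" using u by (intro ennreal_leI) auto
    finally show False using L by simp
  qed
next
  assume R: "\<forall>u\<in>{0..t}. X u \<omega> \<noteq> 0"
  from right_continuous_X[OF \<omega> \<open>0 \<le> t\<close>]
  obtain d where d: "d > t" "\<And>s. t < s \<Longrightarrow> s < d \<Longrightarrow> X s \<omega> = X t \<omega>"
    unfolding eventually_at_right_field by auto
  have "ennreal t < ennreal d" using d \<open>0 \<le> t\<close> by (simp add: ennreal_lessI)
  also have "ennreal d \<le> hitting_time_0 X \<omega>"
    unfolding hitting_time_0_def
  proof (rule Inf_greatest)
    fix y assume "y \<in> {ennreal t |t. 0 \<le> t \<and> X t \<omega> = 0}"
    then obtain s where s: "y = ennreal s" "0 \<le> s" "X s \<omega> = 0" by blast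
    have "d \<le> s"
    proof (rule ccontr)
      assume "\<not> d \<le> s"
      have "X t \<omega> \<noteq> 0" "s \<le> t \<Longrightarrow> X s \<omega> \<noteq> 0" using R s(2) \<open>0 \<le> t\<close> by auto
      thus False using d(2)[of s] s(3) \<open>\<not> d \<le> s\<close> by linarith
    qed
    thus "ennreal d \<le> y" using s by (simp add: ennreal_leI)
  qed
  finally show "ennreal t < hitting_time_0 X \<omega>" .
qed

lemma alive_all_iff:
  assumes "\<omega> \<in> space (P i)" "0 \<le> a" "a \<le> b"
  shows "(\<forall>n. alive a b n \<omega>) \<longleftrightarrow> (\<forall>u\<in>{a..b}. X u \<omega> \<noteq> 0)"
  unfolding alive_def
  by (rule dyadic_detects_value[symmetric])
     (use assms right_continuous_X in auto)

lemma alive_Suc: "alive a b (Suc n) \<omega> \<Longrightarrow> alive a b n \<omega>"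
  unfolding alive_def using dyadic_mono[of n "\<lambda>u. X u \<omega>"] by blast

lemma alive_set:
  assumes "0 \<le> a" "a \<le> b"
  shows "{\<omega> \<in> space (P i). alive a b n \<omega>} \<in> sets (P i)"
proof -
  have "{\<omega> \<in> space (P i). \<forall>k\<le>2^n. X (a + (b - a) * real k / 2^n) \<omega> \<in> - {0}} \<in> sets (P i)"
    using assms by (intro all_X_set) auto
  thus ?thesis by (simp add: alive_def)
qed

lemma prb_decreasing_limit:
  assumes "\<And>n. {\<omega> \<in> space (P j). Q n \<omega>} \<in> sets (P j)" "\<And>n \<omega>. Q (Suc n) \<omega> \<Longrightarrow> Q n \<omega>"
  shows "(\<lambda>n. prb j (Q n)) \<longlonglongrightarrow> prb j (\<lambda>\<omega>. \<forall>n. Q n \<omega>)"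
proof -
  interpret prob_space "P j" by (rule prob_space_P)
  have "(\<lambda>n. prb j (Q n)) \<longlonglongrightarrow> prob (\<Inter>n. {\<omega> \<in> space (P j). Q n \<omega>})"
    using assms by (intro finite_Lim_measure_decseq) (auto simp: decseq_Suc_iff)
  also have "(\<Inter>n. {\<omega> \<in> space (P j). Q n \<omega>}) = {\<omega> \<in> space (P j). \<forall>n. Q n \<omega>}" by auto
  finally show ?thesis .
qed

lemma alive_limit:
  assumes "0 \<le> t"
  shows "(\<lambda>n. prb j (\<lambda>\<omega>. X t \<omega> \<in> K \<and> alive 0 t n \<omega>)) \<longlonglongrightarrow> killed K t j"
proof -
  have "(\<lambda>n. prb j (\<lambda>\<omega>. X t \<omega> \<in> K \<and> alive 0 t n \<omega>)) \<longlonglongrightarrow>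
      prb j (\<lambda>\<omega>. \<forall>n. X t \<omega> \<in> K \<and> alive 0 t n \<omega>)"
    using assms by (intro prb_decreasing_limit sets.sets_Collect_conj X_set alive_set)
      (auto dest: alive_Suc)
  also have "prb j (\<lambda>\<omega>. \<forall>n. X t \<omega> \<in> K \<and> alive 0 t n \<omega>) = killed K t j"
    unfolding killed_def using alive_all_iff[of _ j 0 t] hitting_time_gt_iff[of _ j t] assms
    by (intro arg_cong[of _ _ "measure (P j)"]) auto
  finally show ?thesis .
qed

lemma survive_set:
  assumes "0 \<le> t"
  shows "{\<omega> \<in> space (P j). ennreal t < hitting_time_0 X \<omega>} \<in> sets (P j)"
proof -
  have "{\<omega> \<in> space (P j). \<forall>n. alive 0 t n \<omega>} \<in> sets (P j)"
    using assms by (intro sets.sets_Collect_countable_All alive_set) auto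
  also have "{\<omega> \<in> space (P j). \<forall>n. alive 0 t n \<omega>} = {\<omega> \<in> space (P j). ennreal t < hitting_time_0 X \<omega>}"
    using alive_all_iff[of _ j 0 t] hitting_time_gt_iff[of _ j t] assms by auto
  finally show ?thesis .
qed

lemma killed_set:
  "0 \<le> t \<Longrightarrow> {\<omega> \<in> space (P j). X t \<omega> \<in> K \<and> ennreal t < hitting_time_0 X \<omega>} \<in> sets (P j)"
  by (intro sets.sets_Collect_conj X_set survive_set)

lemma killed_nonneg [simp]: "0 \<le> killed K t j"
  by (simp add: killed_def)

lemma killed_le_1: "killed K t j \<le> 1"
proof -
  interpret prob_space "P j" by (rule prob_space_P)
  show ?thesis by (simp add: killed_def)
qed

lemma killed_mono: "0 \<le> t \<Longrightarrow> K \<subseteq> L \<Longrightarrow> killed K t j \<le> killed L t j"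
proof -
  interpret prob_space "P j" by (rule prob_space_P)
  assume "0 \<le> t" "K \<subseteq> L"
  thus ?thesis unfolding killed_def by (intro finite_measure_mono killed_set) auto
qed

lemma killed_start_0: "killed K t 0 = 0" if "0 \<le> t"
proof -
  interpret prob_space "P 0" by (rule prob_space_P)
  have "AE \<omega> in P 0. \<not> (X t \<omega> \<in> K \<and> ennreal t < hitting_time_0 X \<omega>)"
    using start[of 0] AE_space
    by eventually_elim (use hitting_time_gt_iff[of _ 0 t] that in auto)
  thus ?thesis unfolding killed_def using killed_set[OF that] by (simp add: prob_eq_0 AE_iff_null_sets)
qed

lemma killed_end_0: "killed {0} t j = 0" if "0 \<le> t"
proof -
  have "{\<omega> \<in> space (P j). X t \<omega> \<in> {0} \<and> ennreal t < hitting_time_0 X \<omega>} = {}"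
    using hitting_time_gt_iff[of _ j t] that by auto
  thus ?thesis by (metis killed_def measure_empty)
qed

lemma killed_time_0: "killed K 0 j = of_bool (j \<in> K)" if "j \<ge> 1"
proof -
  interpret prob_space "P j" by (rule prob_space_P)
  have "killed K 0 j = prb j (\<lambda>_. j \<in> K)"
    unfolding killed_def
  proof (rule finite_measure_eq_AE)
    show "AE \<omega> in P j. (\<omega> \<in> {\<omega> \<in> space (P j). X 0 \<omega> \<in> K \<and> ennreal 0 < hitting_time_0 X \<omega>})
      = (\<omega> \<in> {\<omega> \<in> space (P j). j \<in> K})"
      using start[of j] AE_space
      by eventually_elim (use hitting_time_gt_iff[of _ j 0] that in auto)
    show "{\<omega> \<in> space (P j). X 0 \<omega> \<in> K \<and> ennreal 0 < hitting_time_0 X \<omega>} \<in> events"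
      by (rule killed_set) simp
    show "{\<omega> \<in> space (P j). j \<in> K} \<in> events" by (cases "j \<in> K") auto
  qed
  also have "\<dots> = of_bool (j \<in> K)" by (simp add: prob_space)
  finally show ?thesis .
qed

text \<open>The grids on \<open>{0..s}\<close> and \<open>{s..s + t}\<close> are joined into one
  sequence \<open>T\<close>, with \<open>s\<close> at index \<open>N = 2^n\<close>, and
  \<open>block_markov\<close> is applied with the state \<open>l\<close> pinned there. The condition
  \<open>l \<noteq> 0\<close> makes the pin compatible with \<open>alive\<close> at the shared
  endpoint.\<close>

lemma alive_block:
  assumes "0 \<le> s" "0 \<le> t" "l \<noteq> 0"
  shows "prb j (\<lambda>\<omega>. (X s \<omega> \<in> {l} \<and> alive 0 s n \<omega>) \<and> X (s + t) \<omega> \<in> K \<and> alive s (s + t) n \<omega>) =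
    prb j (\<lambda>\<omega>. X s \<omega> \<in> {l} \<and> alive 0 s n \<omega>) * prb l (\<lambda>\<omega>. X t \<omega> \<in> K \<and> alive 0 t n \<omega>)"
proof -
  define N where "N = (2::nat)^n"
  have N: "N > 0" "(2::real)^n = real N" by (auto simp: N_def)
  define T where "T k = (if k \<le> N then s * real k / real N else s + t * (real k - real N) / real N)" for k
  \<comment> \<open>The pin replaces the constraint \<open>- {0}\<close> at the shared endpoint; at
    index \<open>N + N\<close> the set \<open>K - {0}\<close> records both the target and the last
    grid constraint.\<close>
  define A where "A k = (if k < N then - {0} else if k = N then {l} else if k < N + N then - {0} else K - {0})" for k
  have TN: "T N = s" "T (N + k) = s + t * real k / real N" for k using N by (auto simp: T_def)
  have T0: "T k = s * real k / real N" if "k \<le> N" for k using that by (simp add: T_def)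
  have mono: "T k \<le> T (Suc k)" for k
  proof (cases "Suc k \<le> N")
    case True
    thus ?thesis using assms by (simp add: T_def divide_right_mono mult_left_mono)
  next
    case False
    then obtain d where "k = N + d" using le_Suc_ex[of N k] by auto
    moreover have "T (Suc (N + d)) = s + t * real (Suc d) / real N" using TN(2)[of "Suc d"] by simp
    ultimately show ?thesis using assms by (simp add: TN divide_right_mono mult_left_mono)
  qed
  have "prb j (\<lambda>\<omega>. \<forall>k\<le>N+N. X (T k) \<omega> \<in> A k) =
    prb j (\<lambda>\<omega>. \<forall>k\<le>N. X (T k) \<omega> \<in> A k) * prb l (\<lambda>\<omega>. \<forall>k\<le>N. X (T (N+k) - T N) \<omega> \<in> A (N+k))"
    by (rule block_markov) (use mono in \<open>auto simp: A_def T_def\<close>)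
  moreover have first: "(\<forall>k\<le>N. X (T k) \<omega> \<in> A k) \<longleftrightarrow> X s \<omega> \<in> {l} \<and> alive 0 s n \<omega>" for \<omega>
  proof
    assume L: "\<forall>k\<le>N. X (T k) \<omega> \<in> A k"
    have "X s \<omega> = l" using L[rule_format, of N] by (simp add: TN A_def)
    moreover have "X (s * real k / real N) \<omega> \<noteq> 0" if "k \<le> N" for k
      using L[rule_format, OF that] \<open>l \<noteq> 0\<close> T0[OF that] that
      by (auto simp: A_def split: if_splits)
    ultimately show "X s \<omega> \<in> {l} \<and> alive 0 s n \<omega>" by (simp add: alive_def N flip: N_def)
  next
    assume R: "X s \<omega> \<in> {l} \<and> alive 0 s n \<omega>"
    show "\<forall>k\<le>N. X (T k) \<omega> \<in> A k"
    proof (intro allI impI)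
      fix k assume "k \<le> N"
      thus "X (T k) \<omega> \<in> A k"
        using R T0[of k] N by (cases "k = N") (auto simp: A_def alive_def simp flip: N_def)
    qed
  qed
  \<comment> \<open>Offset 0 is left out because the constraint there is the pin and not
    \<open>- {0}\<close>; \<open>split0\<close> restores it. The base time \<open>u\<close> is
    \<open>s\<close> on the full path and 0 on the path restarted in \<open>l\<close>.\<close>
  moreover have second: "(\<forall>k\<le>N. 0 < k \<longrightarrow> f (u + t * real k / real N) \<in> A (N+k)) \<longleftrightarrow>
     f (u + t) \<in> K \<and> (\<forall>k\<le>N. 0 < k \<longrightarrow> f (u + t * real k / real N) \<noteq> 0)" (is "?L \<longleftrightarrow> ?R") for u f
  proof
    assume L: ?L
    have "f (u + t) \<in> K" using L[rule_format, of N] N by (simp add: A_def)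
    moreover have "f (u + t * real k / real N) \<noteq> 0" if "k \<le> N" "0 < k" for k
      using L[rule_format, OF that] that by (auto simp: A_def split: if_splits)
    ultimately show ?R by blast
  next
    assume R: ?R
    show ?L
    proof (intro allI impI)
      fix k assume "k \<le> N" "0 < k"
      thus "f (u + t * real k / real N) \<in> A (N+k)"
        using R N by (cases "k = N") (auto simp: A_def)
    qed
  qed
  have split0: "(\<forall>k\<le>N. Q k) \<longleftrightarrow> Q 0 \<and> (\<forall>k\<le>N. 0 < k \<longrightarrow> Q k)" for Q
    by (metis not_gr_zero zero_le)
  have "(\<forall>k\<le>N+N. X (T k) \<omega> \<in> A k) \<longleftrightarrow>
    (X s \<omega> \<in> {l} \<and> alive 0 s n \<omega>) \<and> X (s + t) \<omega> \<in> K \<and> alive s (s + t) n \<omega>" for \<omega>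
  proof -
    have "(\<forall>k\<le>N+N. X (T k) \<omega> \<in> A k) \<longleftrightarrow>
      (\<forall>k\<le>N. X (T k) \<omega> \<in> A k) \<and> (\<forall>k\<le>N. 0 < k \<longrightarrow> X (T (N+k)) \<omega> \<in> A (N+k))"
      (is "?L \<longleftrightarrow> ?R")
    proof
      assume ?R
      thus ?L by (metis add_le_cancel_left le_Suc_ex nat_le_linear not_gr_zero add_0_right)
    qed auto
    also have "\<dots> \<longleftrightarrow> (X s \<omega> \<in> {l} \<and> alive 0 s n \<omega>) \<and> X (s + t) \<omega> \<in> K \<and>
        (\<forall>k\<le>N. 0 < k \<longrightarrow> X (s + t * real k / real N) \<omega> \<noteq> 0)"
      unfolding first TN(2) second[of "\<lambda>u. X u \<omega>" s] by simp
    also have "\<dots> \<longleftrightarrow> (X s \<omega> \<in> {l} \<and> alive 0 s n \<omega>) \<and> X (s + t) \<omega> \<in> K \<and> alive s (s + t) n \<omega>"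
      unfolding alive_def[of s] N N_def[symmetric] split0[of "\<lambda>k. X (s + (s + t - s) * real k / real N) \<omega> \<noteq> 0"]
      using \<open>l \<noteq> 0\<close> by auto
    finally show ?thesis .
  qed
  moreover have "prb l (\<lambda>\<omega>. \<forall>k\<le>N. X (T (N+k) - T N) \<omega> \<in> A (N+k)) = prb l (\<lambda>\<omega>. X t \<omega> \<in> K \<and> alive 0 t n \<omega>)"
  proof -
    interpret prob_space "P l" by (rule prob_space_P)
    show ?thesis
    \<comment> \<open>The start in \<open>l\<close> is only almost sure, so the two events agree up
      to a null set.\<close>
    proof (rule finite_measure_eq_AE)
      show "AE \<omega> in P l. (\<omega> \<in> {\<omega> \<in> space (P l). \<forall>k\<le>N. X (T (N+k) - T N) \<omega> \<in> A (N+k)})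
        = (\<omega> \<in> {\<omega> \<in> space (P l). X t \<omega> \<in> K \<and> alive 0 t n \<omega>})"
        using start[of l]
      proof eventually_elim
        case (elim \<omega>)
        have "(\<forall>k\<le>N. X (T (N+k) - T N) \<omega> \<in> A (N+k)) \<longleftrightarrow>
          (\<forall>k\<le>N. 0 < k \<longrightarrow> X (0 + t * real k / real N) \<omega> \<in> A (N+k))"
          by (subst split0) (use elim N in \<open>simp add: TN A_def\<close>)
        also have "\<dots> \<longleftrightarrow> X t \<omega> \<in> K \<and> alive 0 t n \<omega>"
          unfolding second[of "\<lambda>u. X u \<omega>" 0] alive_def[of 0] N N_def[symmetric]
             split0[of "\<lambda>k. X (0 + (t - 0) * real k / real N) \<omega> \<noteq> 0"]
          using \<open>l \<noteq> 0\<close> elim by simp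
        finally show ?case by simp
      qed
      show "{\<omega> \<in> space (P l). \<forall>k\<le>N. X (T (N+k) - T N) \<omega> \<in> A (N+k)} \<in> events"
        using assms TN by (intro all_X_set) auto
      show "{\<omega> \<in> space (P l). X t \<omega> \<in> K \<and> alive 0 t n \<omega>} \<in> events"
        using assms by (intro sets.sets_Collect_conj X_set alive_set) auto
    qed
  qed
  ultimately show ?thesis by simp
qed

text \<open>Let the grids in \<open>alive_block\<close> become finer: avoiding 0 on
  \<open>{0..s}\<close> and on \<open>{s..s + t}\<close> is avoiding it on the union. For
  \<open>l = 0\<close> both sides vanish.\<close>

lemma killed_through:
  assumes "0 \<le> s" "0 \<le> t"
  shows "prb j (\<lambda>\<omega>. X s \<omega> = l \<and> X (s + t) \<omega> \<in> K \<and> ennreal (s + t) < hitting_time_0 X \<omega>) =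
    killed {l} s j * killed K t l"
proof (cases "l = 0")
  case True
  hence "{\<omega> \<in> space (P j). X s \<omega> = l \<and> X (s + t) \<omega> \<in> K \<and> ennreal (s + t) < hitting_time_0 X \<omega>} = {}"
    using hitting_time_gt_iff[of _ j "s + t"] assms by auto
  hence "prb j (\<lambda>\<omega>. X s \<omega> = l \<and> X (s + t) \<omega> \<in> K \<and> ennreal (s + t) < hitting_time_0 X \<omega>) = 0"
    by (metis measure_empty)
  thus ?thesis using True killed_start_0[OF assms(2)] by simp
next
  case False
  let ?Q = "\<lambda>n \<omega>. (X s \<omega> \<in> {l} \<and> alive 0 s n \<omega>) \<and> X (s + t) \<omega> \<in> K \<and> alive s (s + t) n \<omega>"
  have "(\<lambda>n. prb j (?Q n)) \<longlonglongrightarrow> prb j (\<lambda>\<omega>. \<forall>n. ?Q n \<omega>)"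
    using assms by (intro prb_decreasing_limit sets.sets_Collect_conj X_set alive_set)
      (auto dest: alive_Suc)
  also have "prb j (\<lambda>\<omega>. \<forall>n. ?Q n \<omega>) =
     prb j (\<lambda>\<omega>. X s \<omega> = l \<and> X (s + t) \<omega> \<in> K \<and> ennreal (s + t) < hitting_time_0 X \<omega>)"
  proof (intro arg_cong[of _ _ "measure (P j)"] Collect_cong conj_cong refl)
    fix \<omega> assume \<omega>: "\<omega> \<in> space (P j)"
    have "(\<forall>n. ?Q n \<omega>) \<longleftrightarrow> X s \<omega> = l \<and> X (s + t) \<omega> \<in> K \<and> (\<forall>n. alive 0 s n \<omega>) \<and> (\<forall>n. alive s (s + t) n \<omega>)"
      by auto
    also have "\<dots> \<longleftrightarrow> X s \<omega> = l \<and> X (s + t) \<omega> \<in> K \<and> (\<forall>u\<in>{0..s + t}. X u \<omega> \<noteq> 0)"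
    proof -
      have "{0..s + t} = {0..s} \<union> {s..s + t}" using assms by auto
      thus ?thesis using alive_all_iff[OF \<omega>, of 0 s] alive_all_iff[OF \<omega>, of s "s + t"] assms by auto
    qed
    finally show "(\<forall>n. ?Q n \<omega>) \<longleftrightarrow> X s \<omega> = l \<and> X (s + t) \<omega> \<in> K \<and> ennreal (s + t) < hitting_time_0 X \<omega>"
      using hitting_time_gt_iff[OF \<omega>, of "s + t"] assms by simp
  qed
  finally have A: "(\<lambda>n. prb j (?Q n)) \<longlonglongrightarrow> prb j (\<lambda>\<omega>. X s \<omega> = l \<and> X (s + t) \<omega> \<in> K \<and> ennreal (s + t) < hitting_time_0 X \<omega>)" .
  have "(\<lambda>n. prb j (\<lambda>\<omega>. X s \<omega> \<in> {l} \<and> alive 0 s n \<omega>) * prb l (\<lambda>\<omega>. X t \<omega> \<in> K \<and> alive 0 t n \<omega>))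
    \<longlonglongrightarrow> killed {l} s j * killed K t l"
    by (intro tendsto_mult alive_limit assms)
  with A show ?thesis unfolding alive_block[OF assms False] by (rule LIMSEQ_unique)
qed

lemma killed_semigroup:
  assumes "0 \<le> s" "0 \<le> t"
  shows "(\<lambda>l. killed {l} s j * killed K t l) sums killed K (s + t) j"
proof -
  interpret prob_space "P j" by (rule prob_space_P)
  let ?E = "\<lambda>l. {\<omega> \<in> space (P j). X s \<omega> = l \<and> X (s + t) \<omega> \<in> K \<and> ennreal (s + t) < hitting_time_0 X \<omega>}"
  have m: "?E l \<in> events" for l
  proof -
    have "{\<omega> \<in> space (P j). X s \<omega> \<in> {l} \<and> X (s + t) \<omega> \<in> K \<and> ennreal (s + t) < hitting_time_0 X \<omega>} \<in> events"
      by (intro sets.sets_Collect_conj X_set survive_set) (use assms in auto)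
    thus ?thesis by (simp only: singleton_iff)
  qed
  have "(\<lambda>l. prob (?E l)) sums prob (\<Union>l. ?E l)"
    using m by (intro finite_measure_UNION) (auto simp: disjoint_family_on_def)
  also have "(\<Union>l. ?E l) = {\<omega> \<in> space (P j). X (s + t) \<omega> \<in> K \<and> ennreal (s + t) < hitting_time_0 X \<omega>}"
    by auto
  finally show ?thesis using killed_through[OF assms] by (simp add: killed_def)
qed

text \<open>That the first grid zero has index \<open>m\<close> depends on deterministic times only
  and leaves the chain in 0, so the simple Markov property does the work of the strong one: being
  away from 0 at time \<open>s\<close> costs a factor at most \<open>\<epsilon>\<close>, uniformly
  in the remaining time.\<close>

lemma first_grid_zero:
  assumes "0 \<le> s" "\<And>u. 0 \<le> u \<Longrightarrow> u \<le> s \<Longrightarrow> 1 - prb 0 (\<lambda>\<omega>. X u \<omega> = 0) \<le> \<epsilon>" "m \<le> N" "0 < N"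
  shows "prb j (\<lambda>\<omega>. ((\<forall>k<m. X (s * real k / real N) \<omega> \<noteq> 0) \<and> X (s * real m / real N) \<omega> = 0) \<and> X s \<omega> \<noteq> 0) \<le>
    \<epsilon> * prb j (\<lambda>\<omega>. (\<forall>k<m. X (s * real k / real N) \<omega> \<noteq> 0) \<and> X (s * real m / real N) \<omega> = 0)"
proof -
  \<comment> \<open>The sequence follows the grid up to index \<open>m\<close> and then jumps to
    \<open>s\<close>, so the block after the zero is a single step.\<close>
  define T where "T k = (if k \<le> m then s * real k / real N else s)" for k
  define A where "A k = (if k = m then {0} else - {0::nat})" for k
  have le: "s * real k / real N \<le> s" if "k \<le> N" for k
  proof -
    have "s * (real k / real N) \<le> s * 1" using that assms by (intro mult_left_mono) auto
    thus ?thesis by simp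
  qed
  have mono: "T k \<le> T (Suc k)" for k
    using assms le[of k] by (auto simp: T_def divide_right_mono mult_left_mono)
  have "prb j (\<lambda>\<omega>. \<forall>k\<le>m+1. X (T k) \<omega> \<in> A k) =
    prb j (\<lambda>\<omega>. \<forall>k\<le>m. X (T k) \<omega> \<in> A k) * prb 0 (\<lambda>\<omega>. \<forall>k\<le>1. X (T (m+k) - T m) \<omega> \<in> A (m+k))"
    by (rule block_markov) (use mono in \<open>auto simp: A_def T_def\<close>)
  moreover have e: "(\<forall>k\<le>m. X (T k) \<omega> \<in> A k) \<longleftrightarrow>
      (\<forall>k<m. X (s * real k / real N) \<omega> \<noteq> 0) \<and> X (s * real m / real N) \<omega> = 0" for \<omega>
  proof
    assume L: "\<forall>k\<le>m. X (T k) \<omega> \<in> A k"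
    have "X (s * real k / real N) \<omega> \<noteq> 0" if "k < m" for k
      using L[rule_format, of k] that by (simp add: T_def A_def)
    with L[rule_format, of m] show "(\<forall>k<m. X (s * real k / real N) \<omega> \<noteq> 0) \<and> X (s * real m / real N) \<omega> = 0"
      by (simp add: T_def A_def)
  qed (simp add: T_def A_def)
  moreover have "(\<forall>k\<le>m+1. X (T k) \<omega> \<in> A k) \<longleftrightarrow> (\<forall>k\<le>m. X (T k) \<omega> \<in> A k) \<and> X s \<omega> \<noteq> 0" for \<omega>
  proof -
    have "(\<forall>k\<le>m+1. Q k) \<longleftrightarrow> (\<forall>k\<le>m. Q k) \<and> Q (Suc m)" for Q
      by (auto simp: le_Suc_eq)
    thus ?thesis by (simp add: T_def A_def)
  qed
  moreover have "prb 0 (\<lambda>\<omega>. \<forall>k\<le>1. X (T (m+k) - T m) \<omega> \<in> A (m+k)) \<le> \<epsilon>"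
  proof -
    interpret prob_space "P 0" by (rule prob_space_P)
    let ?u = "s - s * real m / real N"
    have u: "0 \<le> ?u" "?u \<le> s" using le[OF assms(3)] assms(1) by auto
    have ms: "{\<omega> \<in> space (P 0). X ?u \<omega> \<in> {0}} \<in> events" using u by (intro X_set)
    have "prb 0 (\<lambda>\<omega>. \<forall>k\<le>1. X (T (m+k) - T m) \<omega> \<in> A (m+k)) \<le> prb 0 (\<lambda>\<omega>. X ?u \<omega> \<in> - {0})"
    proof (rule finite_measure_mono)
      show "{\<omega> \<in> space (P 0). \<forall>k\<le>1. X (T (m+k) - T m) \<omega> \<in> A (m+k)} \<subseteq> {\<omega> \<in> space (P 0). X ?u \<omega> \<in> - {0}}"
        by (auto simp: T_def A_def dest!: spec[of _ 1])
    qed (use u in \<open>intro X_set\<close>)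
    also have "{\<omega> \<in> space (P 0). X ?u \<omega> \<in> - {0}} = space (P 0) - {\<omega> \<in> space (P 0). X ?u \<omega> \<in> {0}}" by auto
    also have "prob \<dots> = 1 - prb 0 (\<lambda>\<omega>. X ?u \<omega> = 0)" using prob_compl[OF ms] by simp
    also have "\<dots> \<le> \<epsilon>" using u by (intro assms)
    finally show ?thesis .
  qed
  ultimately show ?thesis
    by (simp add: mult.commute mult_right_mono)
qed

text \<open>Decompose at the first zero on the grid: from there the chain leaves 0 by time \<open>s\<close> with
  probability at most \<open>\<epsilon>\<close>, so a path that hits 0 mostly still sits there at time \<open>s\<close>. This bounds
  both the hitting probability and its part with \<open>X s = k \<noteq> 0\<close>.\<close>

lemma killed_defect:
  assumes "0 \<le> s" and \<epsilon>: "\<And>u. 0 \<le> u \<Longrightarrow> u \<le> s \<Longrightarrow> 1 - prb 0 (\<lambda>\<omega>. X u \<omega> = 0) \<le> \<epsilon>" "\<epsilon> \<le> 1 / 2"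
    and "k \<noteq> 0"
  shows "prb j (\<lambda>\<omega>. X s \<omega> = k) - killed {k} s j \<le> 2 * \<epsilon> * prb j (\<lambda>\<omega>. X s \<omega> = 0)"
proof (rule LIMSEQ_le_const2)
  interpret prob_space "P j" by (rule prob_space_P)
  show "(\<lambda>n. prb j (\<lambda>\<omega>. X s \<omega> = k) - prb j (\<lambda>\<omega>. X s \<omega> \<in> {k} \<and> alive 0 s n \<omega>)) \<longlonglongrightarrow>
    prb j (\<lambda>\<omega>. X s \<omega> = k) - killed {k} s j"
    by (intro tendsto_diff tendsto_const alive_limit assms)
  have "prb j (\<lambda>\<omega>. X s \<omega> = k) - prb j (\<lambda>\<omega>. X s \<omega> \<in> {k} \<and> alive 0 s n \<omega>) \<le>
    2 * \<epsilon> * prb j (\<lambda>\<omega>. X s \<omega> = 0)" for n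
  proof -
    define N where "N = (2::nat)^n"
    have N: "N > 0" "(2::real)^n = real N" by (auto simp: N_def)
    define B where "B m = {\<omega> \<in> space (P j). (\<forall>k<m. X (s * real k / real N) \<omega> \<noteq> 0) \<and> X (s * real m / real N) \<omega> = 0}" for m
    define E where "E K = {\<omega> \<in> space (P j). X s \<omega> \<in> K}" for K
    define Z where "Z = {\<omega> \<in> space (P j). \<not> alive 0 s n \<omega>}"
    have E: "E K \<in> events" for K unfolding E_def using assms by (intro X_set)
    have "space (P j) - {\<omega> \<in> space (P j). alive 0 s n \<omega>} \<in> events"
      using assms by (intro sets.Diff sets.top alive_set) auto
    moreover have "space (P j) - {\<omega> \<in> space (P j). alive 0 s n \<omega>} = Z" by (auto simp: Z_def)
    ultimately have Z: "Z \<in> events" by simp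
    have B: "B m \<in> events" for m
    proof -
      have "{\<omega> \<in> space (P j). \<forall>k\<le>m. X (s * real k / real N) \<omega> \<in> (if k = m then {0} else - {0})} \<in> events"
        using assms by (intro all_X_set) auto
      also have "{\<omega> \<in> space (P j). \<forall>k\<le>m. X (s * real k / real N) \<omega> \<in> (if k = m then {0} else - {0})} = B m"
      proof -
        have "(\<forall>k\<le>m. f k \<in> (if k = m then {0} else - {0})) \<longleftrightarrow> (\<forall>k<m. f k \<noteq> 0) \<and> f m = 0" for f :: "nat \<Rightarrow> nat"
          by (metis ComplI Compl_iff less_imp_le less_irrefl nat_less_le order_refl singleton_iff)
        thus ?thesis by (simp add: B_def)
      qed
      finally show ?thesis .
    qed
    have disj: "disjoint_family_on B {..N}"
      unfolding disjoint_family_on_def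
    proof (intro ballI impI)
      fix a b :: nat assume "a \<noteq> b"
      thus "B a \<inter> B b = {}" by (cases a b rule: linorder_cases) (auto simp: B_def)
    qed
    have UB: "(\<Union>m\<le>N. B m) = Z"
    proof (intro equalityI subsetI)
      fix \<omega> assume "\<omega> \<in> Z"
      hence \<omega>: "\<omega> \<in> space (P j)" "\<exists>m. m \<le> N \<and> X (s * real m / real N) \<omega> = 0"
        by (auto simp: Z_def alive_def N simp flip: N_def)
      define m where "m = (LEAST m. m \<le> N \<and> X (s * real m / real N) \<omega> = 0)"
      have m: "m \<le> N" "X (s * real m / real N) \<omega> = 0"
        using LeastI_ex[OF \<omega>(2)] by (auto simp: m_def)
      have "\<not> (k \<le> N \<and> X (s * real k / real N) \<omega> = 0)" if "k < m" for k
        using not_less_Least[of k "\<lambda>m. m \<le> N \<and> X (s * real m / real N) \<omega> = 0"] that by (simp add: m_def)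
      hence "\<omega> \<in> B m" using \<omega> m by (auto simp: B_def)
      thus "\<omega> \<in> (\<Union>m\<le>N. B m)" using m by blast
    qed (auto simp: B_def Z_def alive_def N simp flip: N_def)
    have "prob (Z \<inter> E (- {0})) = prob (\<Union>m\<le>N. B m \<inter> E (- {0}))" by (simp flip: UB)
    also have "\<dots> = (\<Sum>m\<le>N. prob (B m \<inter> E (- {0})))"
      using disj B E by (intro finite_measure_finite_Union) (auto simp: disjoint_family_on_def)
    also have "\<dots> \<le> (\<Sum>m\<le>N. \<epsilon> * prob (B m))"
    proof (rule sum_mono)
      fix m assume "m \<in> {..N}"
      have "B m \<inter> E (- {0}) = {\<omega> \<in> space (P j). ((\<forall>k<m. X (s * real k / real N) \<omega> \<noteq> 0) \<and>
          X (s * real m / real N) \<omega> = 0) \<and> X s \<omega> \<noteq> 0}" by (auto simp: B_def E_def)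
      thus "prob (B m \<inter> E (- {0})) \<le> \<epsilon> * prob (B m)"
        using first_grid_zero[OF assms(1) \<epsilon>(1), where m = m and N = N and j = j] \<open>m \<in> {..N}\<close> N
        by (simp add: B_def)
    qed
    also have "\<dots> = \<epsilon> * (\<Sum>m\<le>N. prob (B m))" by (simp add: sum_distrib_left)
    also have "(\<Sum>m\<le>N. prob (B m)) = prob (\<Union>m\<le>N. B m)"
      using disj B by (intro finite_measure_finite_Union[symmetric]) auto
    also have "\<dots> = prob Z" by (simp add: UB)
    finally have 1: "prob (Z \<inter> E (- {0})) \<le> \<epsilon> * prob Z" .
    have "Z = (Z \<inter> E {0}) \<union> (Z \<inter> E (- {0}))" by (auto simp: E_def Z_def)
    moreover have "prob ((Z \<inter> E {0}) \<union> (Z \<inter> E (- {0}))) = prob (Z \<inter> E {0}) + prob (Z \<inter> E (- {0}))"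
      by (intro finite_measure_Union sets.Int Z E) (auto simp: E_def)
    ultimately have "prob Z = prob (Z \<inter> E {0}) + prob (Z \<inter> E (- {0}))" by simp
    also have "prob (Z \<inter> E {0}) \<le> prob (E {0})" using E by (intro finite_measure_mono) auto
    finally have "prob Z \<le> prob (E {0}) + \<epsilon> * prob Z" using 1 by simp
    \<comment> \<open>Half of \<open>prob Z\<close> is absorbed on the left-hand side; this is the
      origin of the factor 2 in the bound.\<close>
    also have "\<epsilon> * prob Z \<le> 1 / 2 * prob Z" using \<epsilon>(2) by (intro mult_right_mono) auto
    finally have 2: "prob Z \<le> 2 * prob (E {0})" by simp
    have "0 \<le> \<epsilon>" using \<epsilon>(1)[of 0] prb_X0[of 0] assms(1) by simp
    hence 3: "\<epsilon> * prob Z \<le> 2 * \<epsilon> * prob (E {0})" using mult_left_mono[OF 2] by (simp add: mult_ac)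
    have "E {k} - E {k} \<inter> {\<omega> \<in> space (P j). alive 0 s n \<omega>} = E {k} \<inter> Z" by (auto simp: E_def Z_def)
    hence "prob (E {k} \<inter> Z) = prob (E {k}) - prob (E {k} \<inter> {\<omega> \<in> space (P j). alive 0 s n \<omega>})"
      using E alive_set[of 0 s j n] assms(1) by (subst finite_measure_Diff[symmetric]) auto
    moreover have "E {k} \<inter> {\<omega> \<in> space (P j). alive 0 s n \<omega>} = {\<omega> \<in> space (P j). X s \<omega> \<in> {k} \<and> alive 0 s n \<omega>}"
      by (auto simp: E_def)
    moreover have "prob (E {k} \<inter> Z) \<le> prob (Z \<inter> E (- {0}))"
      by (intro finite_measure_mono sets.Int Z E) (use \<open>k \<noteq> 0\<close> in \<open>auto simp: E_def\<close>)
    ultimately show ?thesis using 1 3 by (simp add: E_def)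
  qed
  thus "\<exists>M. \<forall>n\<ge>M. prb j (\<lambda>\<omega>. X s \<omega> = k) - prb j (\<lambda>\<omega>. X s \<omega> \<in> {k} \<and> alive 0 s n \<omega>) \<le>
    2 * \<epsilon> * prb j (\<lambda>\<omega>. X s \<omega> = 0)" by blast
qed

lemma killed_le_transition: "0 \<le> s \<Longrightarrow> killed {k} s j \<le> prb j (\<lambda>\<omega>. X s \<omega> = k)"
proof -
  interpret prob_space "P j" by (rule prob_space_P)
  assume "0 \<le> s"
  hence "killed {k} s j \<le> prb j (\<lambda>\<omega>. X s \<omega> \<in> {k})"
    unfolding killed_def by (intro finite_measure_mono X_set) auto
  thus ?thesis by simp
qed

lemma transition_quotient:
  "((\<lambda>s. (prb j (\<lambda>\<omega>. X s \<omega> = k) - of_bool (j = k)) / s) \<longlongrightarrow> q j k) (at_right 0)"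
proof -
  have "prb j (\<lambda>\<omega>. X 0 \<omega> = k) = of_bool (j = k)"
  proof (cases "j = k")
    case True thus ?thesis using prb_X0 by simp
  next
    case False
    interpret prob_space "P j" by (rule prob_space_P)
    have "AE \<omega> in P j. \<not> X 0 \<omega> = k" using start[of j] by eventually_elim (use False in auto)
    moreover have "{\<omega> \<in> space (P j). X 0 \<omega> = k} \<in> events" using X_set[of 0 j "{k}"] by simp
    ultimately show ?thesis using False by (simp add: prob_eq_0)
  qed
  moreover have "at 0 within {0..} = at_right (0::real)" by (simp add: at_within_Ici_at_right)
  ultimately show ?thesis
    using derivative_at_0[of j k] by (simp add: has_field_derivative_iff)
qed

text \<open>By \<open>killed_defect\<close> the gap between unkilled and killed probabilities is at
  most \<open>2 * \<epsilon>\<close> times the probability of being in 0 at time \<open>s\<close>.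
  For \<open>j \<ge> 1\<close> the latter is O(s), and \<open>\<epsilon>\<close> may be taken
  arbitrarily small as \<open>s\<close> tends to 0, so the gap is o(s).\<close>

lemma killed_quotient:
  assumes "j \<ge> 1" "k \<ge> 1"
  shows "((\<lambda>s. (killed {k} s j - of_bool (j = k)) / s) \<longlongrightarrow> q j k) (at_right 0)"
proof -
  have "((\<lambda>s. (prb j (\<lambda>\<omega>. X s \<omega> = k) - killed {k} s j) / s) \<longlongrightarrow> 0) (at_right 0)"
  proof (rule tendstoI)
    fix e :: real assume "e > 0"
    define C where "C = q j 0 + 1"
    have "q j 0 \<ge> 0" using Q_matrix_q assms by (auto simp: Q_matrix_def)
    hence C: "C > 0" by (simp add: C_def)
    \<comment> \<open>The cap \<open>1/2\<close> is required by \<open>killed_defect\<close>; the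
      other bound gives \<open>2 * (e / (4 * C)) * (C * s) = e / 2 * s\<close>. The margin 1 in
      \<open>C\<close> makes the probability of 0 eventually less than \<open>C * s\<close>.\<close>
    define \<epsilon> where "\<epsilon> = min (1/2) (e / (4 * C))"
    have \<epsilon>: "\<epsilon> > 0" "\<epsilon> \<le> 1/2" "\<epsilon> \<le> e / (4 * C)" using C \<open>e > 0\<close> by (auto simp: \<epsilon>_def)
    have "((\<lambda>s. (prb 0 (\<lambda>\<omega>. X s \<omega> = 0) - 1) / s * s + 1) \<longlongrightarrow> q 0 0 * 0 + 1) (at_right 0)"
      using transition_quotient[of 0 0] by (intro tendsto_intros) auto
    hence "((\<lambda>s. prb 0 (\<lambda>\<omega>. X s \<omega> = 0)) \<longlongrightarrow> 1) (at_right 0)"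
      by (rule Lim_transform_eventually[OF tendsto_eq_rhs])
         (auto simp: eventually_at_right_field intro!: exI[of _ 1])
    hence "eventually (\<lambda>s. prb 0 (\<lambda>\<omega>. X s \<omega> = 0) > 1 - \<epsilon>) (at_right 0)"
      using \<epsilon>(1) by (intro order_tendstoD(1)) auto
    then obtain d where d: "d > 0" "\<And>s. 0 < s \<Longrightarrow> s < d \<Longrightarrow> prb 0 (\<lambda>\<omega>. X s \<omega> = 0) > 1 - \<epsilon>"
      unfolding eventually_at_right_field by auto
    have d': "1 - prb 0 (\<lambda>\<omega>. X u \<omega> = 0) \<le> \<epsilon>" if "0 \<le> u" "u < d" for u
      using d(2)[of u] that prb_X0[of 0] \<epsilon>(1) by (cases "u = 0") auto
    have "eventually (\<lambda>s. (prb j (\<lambda>\<omega>. X s \<omega> = 0) - of_bool (j = 0)) / s < C) (at_right 0)"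
      using transition_quotient[of j 0] by (intro order_tendstoD(2)) (auto simp: C_def)
    moreover have "eventually (\<lambda>s. s < d) (at_right 0)" "eventually (\<lambda>s. s > (0::real)) (at_right 0)"
      using d(1) by (auto simp: eventually_at_right_field)
    ultimately show "eventually (\<lambda>s. dist ((prb j (\<lambda>\<omega>. X s \<omega> = k) - killed {k} s j) / s) 0 < e) (at_right 0)"
    proof eventually_elim
      case (elim s)
      have "prb j (\<lambda>\<omega>. X s \<omega> = 0) \<le> C * s" using elim assms by (simp add: field_simps)
      have "prb j (\<lambda>\<omega>. X s \<omega> = k) - killed {k} s j \<le> 2 * \<epsilon> * prb j (\<lambda>\<omega>. X s \<omega> = 0)"
        using elim assms \<epsilon> d' by (intro killed_defect) auto
      also have "\<dots> \<le> 2 * (e / (4 * C)) * (C * s)"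
        using \<epsilon> C elim \<open>prb j (\<lambda>\<omega>. X s \<omega> = 0) \<le> C * s\<close> by (intro mult_mono) auto
      also have "\<dots> = e / 2 * s" using C by simp
      finally have "(prb j (\<lambda>\<omega>. X s \<omega> = k) - killed {k} s j) / s \<le> e / 2" using elim by (simp add: field_simps)
      moreover have "0 \<le> (prb j (\<lambda>\<omega>. X s \<omega> = k) - killed {k} s j) / s"
        using killed_le_transition[of s k j] elim by simp
      ultimately show ?case using \<open>e > 0\<close> unfolding dist_real_def diff_0_right by linarith
    qed
  qed
  from tendsto_diff[OF transition_quotient[of j k] this] show ?thesis
    by (simp add: diff_divide_distrib[symmetric])
qed

end

section \<open>The backward equation\<close>

locale killed_birth_death = markov_chain P X q
  for P :: "nat \<Rightarrow> 'a measure" and X :: "real \<Rightarrow> 'a \<Rightarrow> nat" and q :: "nat \<Rightarrow> nat \<Rightarrow> real" +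
  assumes birth_death: "\<And>k j. k \<ge> 1 \<Longrightarrow> \<bar>int k - int j\<bar> > 1 \<Longrightarrow> q k j = 0"
    and killed_irred: "killed_irreducible P X"
begin

text \<open>For \<open>j \<ge> 1\<close> this is \<open>(Qv)_j\<close>, with the row reduced to its
  three possibly nonzero entries. The value \<open>v 0\<close> enters at \<open>j = 1\<close>, and
  killing amounts to \<open>v 0 = 0\<close>.\<close>

definition gen :: "nat \<Rightarrow> (nat \<Rightarrow> real) \<Rightarrow> real" where
  "gen j v = q j (j - 1) * v (j - 1) + q j j * v j + q j (j + 1) * v (j + 1)"

lemma row_sum: "j \<ge> 1 \<Longrightarrow> (\<Sum>l\<in>{j - 1, j, j + 1}. q j l) = 0"
proof -
  assume j: "j \<ge> 1"
  have "q j l = 0" if "l \<notin> {j - 1, j, j + 1}" for l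
    by (rule birth_death[OF j]) (use that in auto)
  hence "(q j has_sum 0) UNIV \<longleftrightarrow> (q j has_sum 0) {j - 1, j, j + 1}"
    by (intro has_sum_cong_neutral) auto
  moreover have "(q j has_sum 0) UNIV" using Q_matrix_q by (auto simp: Q_matrix_def)
  moreover have "(q j has_sum (\<Sum>l\<in>{j - 1, j, j + 1}. q j l)) {j - 1, j, j + 1}"
    by (intro has_sum_finite) auto
  ultimately show ?thesis by (metis has_sum_unique)
qed

text \<open>Bounds the error of the first-order expansion in \<open>s\<close> at \<open>j\<close>,
  independently of \<open>K\<close> and of the base time \<open>t\<close>: errors of the
  neighbouring entries plus the mass sent elsewhere. State 0 is left out because the killed chain
  puts no mass there although \<open>q 1 0\<close> may be positive; the functions expanded vanish at
  0.\<close>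

definition defect :: "nat \<Rightarrow> real \<Rightarrow> real" where
  "defect j s = (\<Sum>l\<in>{j - 1, j, j + 1} - {0}. \<bar>killed {l} s j - of_bool (j = l) - s * q j l\<bar>) +
     killed (- {j - 1, j, j + 1}) s j"

lemma killed_sums:
  assumes "0 \<le> s"
  shows "(\<lambda>l. killed {l} s j * of_bool (l \<in> K)) sums killed K s j"
proof -
  have "killed {l} s j * killed K 0 l = killed {l} s j * of_bool (l \<in> K)" for l
    using killed_end_0[OF assms] killed_time_0[of l K] by (cases "l = 0") auto
  thus ?thesis using killed_semigroup[OF assms order_refl, of j K] by (simp only: add_0_right)
qed

lemma killed_expansion:
  assumes "0 \<le> s" "j \<ge> 1" and v: "v 0 = 0" "\<And>l. \<bar>v l\<bar> \<le> 1"
    and V: "(\<lambda>l. killed {l} s j * v l) sums V"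
  shows "\<bar>V - v j - s * gen j v\<bar> \<le> defect j s"
proof -
  let ?F = "{j - 1, j, j + 1}"
  let ?w = "\<lambda>l. killed {l} s j"
  have "(\<lambda>l. if l \<in> ?F then ?w l * v l else 0) sums (\<Sum>l\<in>?F. ?w l * v l)"
    by (intro sums_If_finite_set) auto
  from sums_diff[OF V this]
  have R: "(\<lambda>l. ?w l * v l * of_bool (l \<notin> ?F)) sums (V - (\<Sum>l\<in>?F. ?w l * v l))"
    by (rule sums_cong[THEN iffD1, rotated]) auto
  have b: "\<bar>?w l * v l * of_bool (l \<notin> ?F)\<bar> \<le> ?w l * of_bool (l \<in> - ?F)" for l
    using mult_left_mono[OF v(2)[of l], of "?w l"] by (auto simp: abs_mult)
  note K = killed_sums[OF assms(1), of j "- ?F"]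
  have "V - (\<Sum>l\<in>?F. ?w l * v l) \<le> killed (- ?F) s j"
    by (rule sums_le[OF _ R K]) (use b abs_le_D1 in blast)
  moreover have "- (V - (\<Sum>l\<in>?F. ?w l * v l)) \<le> killed (- ?F) s j"
    by (rule sums_le[OF _ sums_minus[OF R] K]) (use b abs_le_D2 in blast)
  ultimately have 1: "\<bar>V - (\<Sum>l\<in>?F. ?w l * v l)\<bar> \<le> killed (- ?F) s j" by linarith
  have "(\<Sum>l\<in>?F. ?w l * v l) - v j - s * gen j v = (\<Sum>l\<in>?F. (?w l - of_bool (j = l) - s * q j l) * v l)"
    using assms(2) unfolding gen_def by (cases j) (simp_all add: algebra_simps)
  also have "\<dots> = (\<Sum>l\<in>?F - {0}. (?w l - of_bool (j = l) - s * q j l) * v l)"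
    using v(1) by (intro sum.mono_neutral_right) auto
  also have "\<bar>\<dots>\<bar> \<le> (\<Sum>l\<in>?F - {0}. \<bar>?w l - of_bool (j = l) - s * q j l\<bar>)"
    using mult_left_mono[OF v(2)] by (intro order_trans[OF sum_abs] sum_mono) (auto simp: abs_mult)
  finally show ?thesis using 1 by (simp add: defect_def)
qed

text \<open>The neighbouring entries are handled by \<open>killed_quotient\<close>. The mass
  elsewhere is at most one minus three unkilled probabilities, whose quotient tends to minus the row
  sum, which is 0; so no derivative of an infinite sum is taken.\<close>

lemma defect_small:
  assumes "j \<ge> 1"
  shows "((\<lambda>s. defect j s / s) \<longlongrightarrow> 0) (at_right 0)"
proof -
  interpret prob_space "P j" by (rule prob_space_P)
  let ?F = "{j - 1, j, j + 1}"
  have "((\<lambda>s. \<Sum>l\<in>?F - {0}. \<bar>(killed {l} s j - of_bool (j = l)) / s - q j l\<bar>) \<longlongrightarrow>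
      (\<Sum>l\<in>?F - {0}. \<bar>q j l - q j l\<bar>)) (at_right 0)"
    using assms by (intro tendsto_intros killed_quotient) auto
  hence "((\<lambda>s. (\<Sum>l\<in>?F - {0}. \<bar>killed {l} s j - of_bool (j = l) - s * q j l\<bar>) / s) \<longlongrightarrow>
      (\<Sum>l\<in>?F - {0}. \<bar>q j l - q j l\<bar>)) (at_right 0)"
  proof (rule Lim_transform_eventually)
    have "(\<Sum>l\<in>?F - {0}. \<bar>(killed {l} s j - of_bool (j = l)) / s - q j l\<bar>) =
       (\<Sum>l\<in>?F - {0}. \<bar>killed {l} s j - of_bool (j = l) - s * q j l\<bar>) / s" if "s > 0" for s
    proof -
      have "\<bar>(killed {l} s j - of_bool (j = l)) / s - q j l\<bar> = \<bar>killed {l} s j - of_bool (j = l) - s * q j l\<bar> / s" for l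
      proof -
        have "(killed {l} s j - of_bool (j = l)) / s - q j l = (killed {l} s j - of_bool (j = l) - s * q j l) / s"
          using that by (simp add: diff_divide_distrib)
        thus ?thesis using that by (simp only: abs_divide abs_of_pos)
      qed
      thus ?thesis by (simp only: sum_divide_distrib)
    qed
    thus "\<forall>\<^sub>F s in at_right 0. (\<Sum>l\<in>?F - {0}. \<bar>(killed {l} s j - of_bool (j = l)) / s - q j l\<bar>) =
       (\<Sum>l\<in>?F - {0}. \<bar>killed {l} s j - of_bool (j = l) - s * q j l\<bar>) / s"
      by (auto simp: eventually_at_right_field intro!: exI[of _ 1])
  qed
  moreover have "((\<lambda>s. killed (- ?F) s j / s) \<longlongrightarrow> 0) (at_right 0)"
  proof (rule tendsto_sandwich[OF _ _ tendsto_const])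
    have "((\<lambda>s. - (\<Sum>l\<in>?F. (prb j (\<lambda>\<omega>. X s \<omega> = l) - of_bool (j = l)) / s)) \<longlongrightarrow> - (\<Sum>l\<in>?F. q j l)) (at_right 0)"
      by (intro tendsto_minus tendsto_sum transition_quotient)
    thus "((\<lambda>s. - (\<Sum>l\<in>?F. (prb j (\<lambda>\<omega>. X s \<omega> = l) - of_bool (j = l)) / s)) \<longlongrightarrow> 0) (at_right 0)"
      using row_sum[OF assms] by simp
    have pos: "eventually (\<lambda>s. s > (0::real)) (at_right 0)" by (rule eventually_at_right_less)
    show "\<forall>\<^sub>F s in at_right 0. 0 \<le> killed (- ?F) s j / s" using pos by eventually_elim auto
    show "\<forall>\<^sub>F s in at_right 0. killed (- ?F) s j / s \<le>
        - (\<Sum>l\<in>?F. (prb j (\<lambda>\<omega>. X s \<omega> = l) - of_bool (j = l)) / s)"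
      using pos
    proof eventually_elim
      case (elim s)
      let ?E = "\<lambda>l. {\<omega> \<in> space (P j). X s \<omega> \<in> {l}}"
      have E: "?E l \<in> events" for l using elim by (intro X_set) auto
      have U: "prob (\<Union>l\<in>?F. ?E l) = (\<Sum>l\<in>?F. prob (?E l))"
        using E by (intro finite_measure_finite_Union) (auto simp: disjoint_family_on_def)
      have D: "{\<omega> \<in> space (P j). X s \<omega> \<in> - ?F} = space (P j) - (\<Union>l\<in>?F. ?E l)" by auto
      have "(\<Union>l\<in>?F. ?E l) \<in> events" using E by (intro sets.finite_UN) auto
      hence "prb j (\<lambda>\<omega>. X s \<omega> \<in> - ?F) = 1 - (\<Sum>l\<in>?F. prob (?E l))"
        unfolding D using U by (simp only: prob_compl)
      also have "\<dots> = - (\<Sum>l\<in>?F. prb j (\<lambda>\<omega>. X s \<omega> = l) - of_bool (j = l))" using assms by (cases j) simp_all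
      finally have "prb j (\<lambda>\<omega>. X s \<omega> \<in> - ?F) = - (\<Sum>l\<in>?F. prb j (\<lambda>\<omega>. X s \<omega> = l) - of_bool (j = l))" .
      moreover have "killed (- ?F) s j \<le> prb j (\<lambda>\<omega>. X s \<omega> \<in> - ?F)"
        unfolding killed_def by (intro finite_measure_mono X_set) (use elim in auto)
      ultimately have "killed (- ?F) s j / s \<le> (- (\<Sum>l\<in>?F. prb j (\<lambda>\<omega>. X s \<omega> = l) - of_bool (j = l))) / s"
        using elim by (intro divide_right_mono) auto
      also have "\<dots> = - (\<Sum>l\<in>?F. (prb j (\<lambda>\<omega>. X s \<omega> = l) - of_bool (j = l)) / s)"
        by (simp only: sum_divide_distrib minus_divide_left[symmetric])
      finally show ?case .
    qed
  qed
  ultimately have "((\<lambda>s. (\<Sum>l\<in>?F - {0}. \<bar>killed {l} s j - of_bool (j = l) - s * q j l\<bar>) / s + killed (- ?F) s j / s)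
      \<longlongrightarrow> (\<Sum>l\<in>?F - {0}. \<bar>q j l - q j l\<bar>) + 0) (at_right 0)"
    by (rule tendsto_add)
  thus ?thesis unfolding defect_def add_divide_distrib by simp
qed

lemma killed_increment:
  assumes "0 \<le> s" "0 \<le> t" "j \<ge> 1"
  shows "\<bar>killed K (t + s) j - killed K t j - s * gen j (killed K t)\<bar> \<le> defect j s"
proof (rule killed_expansion[OF assms(1,3)])
  show "(\<lambda>l. killed {l} s j * killed K t l) sums killed K (t + s) j"
    using killed_semigroup[OF assms(1,2), of j K] by (simp add: add.commute)
qed (use killed_start_0[OF assms(2)] killed_le_1 in auto)

lemma gen_bound:
  assumes "\<And>l. \<bar>v l\<bar> \<le> 1"
  shows "\<bar>gen j v\<bar> \<le> \<bar>q j (j - 1)\<bar> + \<bar>q j j\<bar> + \<bar>q j (j + 1)\<bar>"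
proof -
  have "\<bar>a * v l\<bar> \<le> \<bar>a\<bar>" for a l using mult_left_mono[OF assms[of l], of "\<bar>a\<bar>"] by (simp add: abs_mult)
  from this[of "q j (j-1)" "j-1"] this[of "q j j" j] this[of "q j (j+1)" "j+1"]
  show ?thesis unfolding gen_def by linarith
qed

text \<open>The forward increment bound is uniform in the base time, so starting from the earlier of
  two times gives continuity from both sides.\<close>

lemma killed_continuous: "continuous_on {0..} (\<lambda>t. killed K t j)"
proof (cases "j = 0")
  case True
  have "continuous_on {0..} (\<lambda>t::real. 0::real) \<longleftrightarrow> continuous_on {0..} (\<lambda>t. killed K t j)"
    by (intro continuous_on_cong) (auto simp: True killed_start_0)
  thus ?thesis by simp
next
  case False
  hence j: "j \<ge> 1" by simp
  let ?Q = "\<bar>q j (j - 1)\<bar> + \<bar>q j j\<bar> + \<bar>q j (j + 1)\<bar>"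
  have "((\<lambda>s. defect j s / s * s + s * ?Q) \<longlongrightarrow> 0 * 0 + 0 * ?Q) (at_right 0)"
    using defect_small[OF j] by (intro tendsto_intros)
  hence lim: "((\<lambda>s. defect j s / s * s + s * ?Q) \<longlongrightarrow> 0) (at_right 0)" by simp
  show ?thesis
    unfolding continuous_on_iff
  proof (intro ballI allI impI)
    fix t e :: real assume t: "t \<in> {0..}" and "e > 0"
    from order_tendstoD(2)[OF lim \<open>e > 0\<close>] obtain d where
      d: "d > 0" "\<And>s. 0 < s \<Longrightarrow> s < d \<Longrightarrow> defect j s / s * s + s * ?Q < e"
      unfolding eventually_at_right_field by auto
    have step: "\<bar>killed K (a + s) j - killed K a j\<bar> < e" if "a \<ge> 0" "0 < s" "s < d" for a s
    proof -
      have "\<bar>s * gen j (killed K a)\<bar> \<le> s * ?Q"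
        using gen_bound[of "killed K a" j] killed_le_1 that by (auto simp: abs_mult)
      moreover have "\<bar>killed K (a + s) j - killed K a j - s * gen j (killed K a)\<bar> \<le> defect j s"
        using that j by (intro killed_increment) auto
      moreover have "defect j s + s * ?Q < e" using d(2)[of s] that by simp
      ultimately show ?thesis by linarith
    qed
    have "dist (killed K y j) (killed K t j) < e" if "y \<in> {0..}" "dist y t < d" for y
    proof (cases y t rule: linorder_cases)
      case less
      thus ?thesis using step[of y "t - y"] that by (simp add: dist_real_def)
    next
      case greater
      thus ?thesis using step[of t "y - t"] that t by (simp add: dist_real_def)
    qed (use \<open>e > 0\<close> in simp)
    thus "\<exists>d>0. \<forall>y\<in>{0..}. dist y t < d \<longrightarrow> dist (killed K y j) (killed K t j) < e" using d(1) by blast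
  qed
qed

lemma gen_continuous: "continuous_on {0..} (\<lambda>t. gen j (killed K t))"
  unfolding gen_def by (intro continuous_intros killed_continuous)

lemma backward_equation:
  assumes "0 \<le> t" "j \<ge> 1"
  shows "((\<lambda>t. killed K t j) has_real_derivative gen j (killed K t)) (at t within {0..})"
  unfolding has_field_derivative_iff
proof (rule tendstoI)
  fix e :: real assume "e > 0"
  hence "e / 2 > 0" by simp
  from order_tendstoD(2)[OF defect_small[OF assms(2)] this] obtain d1 where
    d1: "d1 > 0" "\<And>s. 0 < s \<Longrightarrow> s < d1 \<Longrightarrow> defect j s / s < e / 2"
    unfolding eventually_at_right_field by auto
  from gen_continuous[of j K] \<open>e / 2 > 0\<close> assms(1) obtain d2 where
    d2: "d2 > 0" "\<And>y. 0 \<le> y \<Longrightarrow> dist y t < d2 \<Longrightarrow> dist (gen j (killed K y)) (gen j (killed K t)) < e / 2"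
    unfolding continuous_on_iff by (metis atLeast_iff)
  have "dist ((killed K y j - killed K t j) / (y - t)) (gen j (killed K t)) < e"
    if y: "y \<ge> 0" "y \<noteq> t" "dist y t < min d1 d2" for y
  proof -
    \<comment> \<open>\<open>killed_increment\<close> only moves forward, so the quotient is
      compared with the generator at the earlier time \<open>a\<close>; continuity of the generator
      then moves it to \<open>t\<close>.\<close>
    define a where "a = min y t"
    define s where "s = \<bar>y - t\<bar>"
    have s: "s > 0" "s < d1" using y by (auto simp: s_def dist_real_def)
    have a: "a \<ge> 0" "dist a t < d2" using y assms(1) d2(1) by (cases "y \<le> t"; simp add: a_def)+
    have quot: "(killed K y j - killed K t j) / (y - t) = (killed K (a + s) j - killed K a j) / s"
    proof (cases "y < t")
      case True
      hence "a = y" "s = t - y" by (auto simp: a_def s_def)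
      thus ?thesis using True by (simp add: divide_simps) (simp add: algebra_simps)
    next
      case False
      hence "a = t" "s = y - t" using y by (auto simp: a_def s_def)
      thus ?thesis by simp
    qed
    have "(killed K (a + s) j - killed K a j) / s - gen j (killed K a) =
       (killed K (a + s) j - killed K a j - s * gen j (killed K a)) / s"
      using s by (simp add: diff_divide_distrib)
    also have "\<bar>\<dots>\<bar> = \<bar>killed K (a + s) j - killed K a j - s * gen j (killed K a)\<bar> / s" using s by simp
    also have "\<dots> \<le> defect j s / s"
      using s a assms by (intro divide_right_mono killed_increment) auto
    also have "\<dots> < e / 2" using d1(2) s by auto
    finally have "\<bar>(killed K (a + s) j - killed K a j) / s - gen j (killed K a)\<bar> < e / 2" .
    moreover have "\<bar>gen j (killed K a) - gen j (killed K t)\<bar> < e / 2"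
      using d2(2)[OF a] by (simp add: dist_real_def)
    ultimately show ?thesis unfolding quot dist_real_def by linarith
  qed
  thus "\<forall>\<^sub>F y in at t within {0..}. dist ((killed K y j - killed K t j) / (y - t)) (gen j (killed K t)) < e"
    unfolding eventually_at using d1(1) d2(1) by (intro exI[of _ "min d1 d2"]) auto
qed

section \<open>Harmonic functions and ratio limits\<close>

lemma q_nonneg: "j \<noteq> k \<Longrightarrow> 0 \<le> q j k"
  using Q_matrix_q by (auto simp: Q_matrix_def)

text \<open>The zero row sum eliminates \<open>q j j\<close>, which leaves a relation between
  consecutive increments of \<open>v\<close> only.\<close>

lemma gen_flux:
  assumes "j \<ge> 1"
  shows "gen j v = q j (j + 1) * (v (j + 1) - v j) - q j (j - 1) * (v j - v (j - 1))"
proof -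
  have qjj: "q j j = - q j (j + 1) - q j (j - 1)"
    using row_sum[OF assms] assms by (cases j) (simp_all add: algebra_simps)
  show ?thesis unfolding gen_def qjj by (simp add: algebra_simps)
qed

lemma killed_DERIV:
  assumes "0 < t" "j \<ge> 1"
  shows "DERIV (\<lambda>t. killed K t j) t :> gen j (killed K t)"
proof -
  have "at t within {0..} = at t" using assms(1) by (intro at_within_interior) simp
  thus ?thesis using backward_equation[of t j K] assms by simp
qed

text \<open>Without births from \<open>j\<close>, the probabilities of being above \<open>j\<close> solve a linear
  system on \<open>{1..j}\<close> with zero initial value, so they vanish by Gronwall.\<close>

lemma birth_rate_pos:
  assumes j: "j \<ge> 1"
  shows "0 < q j (j + 1)"
proof (rule ccontr)
  assume "\<not> 0 < q j (j + 1)"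
  hence q0: "q j (j + 1) = 0" using q_nonneg[of j "j + 1"] by simp
  define u where "u t l = killed {j<..} t l" for t l
  define S where "S t = (\<Sum>l\<in>{1..j}. u t l)" for t
  define c where "c l = \<bar>q l (l - 1)\<bar> + \<bar>q l l\<bar> + \<bar>q l (l + 1)\<bar>" for l
  define C where "C = (\<Sum>l\<in>{1..j}. c l)"
  have u0: "u t l \<ge> 0" for t l by (simp add: u_def)
  have uS: "u t l \<le> S t" if "l \<in> {1..j}" for t l
    unfolding S_def using that u0 by (intro member_le_sum) auto
  have S0: "0 \<le> S t" for t unfolding S_def by (intro sum_nonneg u0)
  have gb: "gen l (u t) \<le> c l * S t" if "l \<in> {1..j}" "0 \<le> t" for l t
  proof -
    have b: "a * u t k \<le> \<bar>a\<bar> * S t" if "k \<in> {0..j}" for a k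
    proof -
      have "u t k \<le> S t" using uS[of k t] that S0[of t] killed_start_0[OF \<open>0 \<le> t\<close>]
        by (cases "k = 0") (auto simp: u_def)
      hence "\<bar>a\<bar> * u t k \<le> \<bar>a\<bar> * S t" by (intro mult_left_mono) auto
      moreover have "a * u t k \<le> \<bar>a\<bar> * u t k" using u0 by (intro mult_right_mono) auto
      ultimately show ?thesis by linarith
    qed
    \<comment> \<open>Here the system closes: for \<open>l = j\<close> the neighbour
      \<open>j + 1\<close> lies outside \<open>{1..j}\<close>, but its coefficient is 0 by
      \<open>q0\<close>.\<close>
    have "q l (l + 1) * u t (l + 1) \<le> \<bar>q l (l + 1)\<bar> * S t"
      using b[of "l + 1" "q l (l + 1)"] q0 that by (cases "l = j") auto
    moreover have "q l (l - 1) * u t (l - 1) \<le> \<bar>q l (l - 1)\<bar> * S t" "q l l * u t l \<le> \<bar>q l l\<bar> * S t"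
      using that(1) by (auto intro!: b)
    ultimately show ?thesis unfolding gen_def c_def distrib_right by linarith
  qed
  have vanish: "S t = 0" if "0 \<le> t" for t
  proof -
    \<comment> \<open>Integrating factor: \<open>S' \<le> C * S\<close> makes this function
      nonincreasing, and it starts at 0 because no state of \<open>{1..j}\<close> lies above
      \<open>j\<close>.\<close>
    let ?g = "\<lambda>t. exp (- (C * t)) * S t"
    have "?g t \<le> ?g 0"
    proof (rule DERIV_nonpos_imp_decreasing_open[OF that])
      fix x :: real assume "0 < x"
      let ?D = "\<Sum>l\<in>{1..j}. gen l (u x)"
      have "DERIV S x :> ?D"
        unfolding S_def u_def using \<open>0 < x\<close> by (intro DERIV_sum killed_DERIV) auto
      hence "DERIV ?g x :> exp (- (C * x)) * (?D - C * S x)"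
        by (auto intro!: derivative_eq_intros simp: algebra_simps)
      moreover have "?D \<le> (\<Sum>l\<in>{1..j}. c l * S x)" using gb \<open>0 < x\<close> by (intro sum_mono) auto
      hence "?D \<le> C * S x" by (simp add: C_def sum_distrib_right)
      hence "exp (- (C * x)) * (?D - C * S x) \<le> 0" by (simp add: mult_nonneg_nonpos)
      ultimately show "\<exists>y. DERIV ?g x :> y \<and> y \<le> 0" by blast
    next
      have "continuous_on {0..t} S"
        unfolding S_def u_def
        by (intro continuous_on_sum continuous_on_subset[OF killed_continuous]) auto
      thus "continuous_on {0..t} ?g" by (intro continuous_intros)
    qed
    moreover have "S 0 = 0" by (simp add: S_def u_def killed_time_0)
    ultimately have "exp (- (C * t)) * S t \<le> 0" by simp
    hence "S t \<le> 0" by (simp add: mult_le_0_iff)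
    thus ?thesis using S0[of t] by simp
  qed
  obtain t where t: "t > 0" "0 < killed_transition P X t j (j + 1)"
    using killed_irred j unfolding killed_irreducible_def by (metis le_add2)
  have "killed_transition P X t j (j + 1) = killed {j + 1} t j"
    by (simp add: killed_transition_def killed_def)
  also have "\<dots> \<le> u t j" unfolding u_def using t by (intro killed_mono) auto
  also have "\<dots> \<le> S t" using j by (intro uS) auto
  finally show False using vanish[of t] t by simp
qed

text \<open>\<open>slope n\<close> is the increment from \<open>n\<close> to \<open>n + 1\<close> of
  the harmonic function: equating \<open>gen_flux\<close> to 0 at state \<open>n + 1\<close> gives
  the factor death rate over birth rate, and \<open>slope 0 = 1\<close> encodes the value 1 at state
  1.\<close>

primrec slope :: "nat \<Rightarrow> real" where
  "slope 0 = 1"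
| "slope (Suc n) = q (n + 1) n / q (n + 1) (n + 2) * slope n"

text \<open>The scale function of the birth and death chain, vanishing at 0; it is the witness for
  \<beta>.\<close>

definition natural_scale :: "nat \<Rightarrow> real" where
  "natural_scale j = (\<Sum>n<j. slope n)"

lemma slope_nonneg: "0 \<le> slope n"
proof (induction n)
  case (Suc n)
  thus ?case using q_nonneg[of "n + 1" n] q_nonneg[of "n + 1" "n + 2"] by simp
qed simp

lemma natural_scale_0 [simp]: "natural_scale 0 = 0" and natural_scale_1 [simp]: "natural_scale (Suc 0) = 1"
  by (simp_all add: natural_scale_def)

lemma natural_scale_Suc: "natural_scale (Suc j) = natural_scale j + slope j"
  by (simp add: natural_scale_def)

lemma natural_scale_pos: "j \<ge> 1 \<Longrightarrow> 0 < natural_scale j"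
proof (induction j rule: nat_induct_at_least)
  case (Suc n)
  thus ?case using slope_nonneg[of n] by (simp add: natural_scale_Suc)
qed simp

lemma natural_scale_nonneg: "0 \<le> natural_scale j"
  unfolding natural_scale_def by (intro sum_nonneg slope_nonneg)

lemma slope_flux: "q (n + 1) (n + 2) * slope (Suc n) = q (n + 1) n * slope n"
  using birth_rate_pos[of "n + 1"] by simp

text \<open>The error of the increment recursion at \<open>n + 1\<close> is a fixed multiple of the
  error at \<open>n\<close> plus the generator divided by the birth rate, so each error tends to 0
  by induction, and finitely many of them add up. The filter is arbitrary so that a constant family
  gives the exact statement \<open>harmonic_unique\<close>.\<close>

lemma approximately_harmonic_limit:
  fixes r :: "'b \<Rightarrow> nat \<Rightarrow> real"
  assumes r0: "\<And>t. r t 0 = 0" and gen: "\<And>j. j \<ge> 1 \<Longrightarrow> ((\<lambda>t. gen j (r t)) \<longlongrightarrow> 0) F"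
  shows "((\<lambda>t. r t j - natural_scale j * r t 1) \<longlongrightarrow> 0) F"
proof -
  have step: "((\<lambda>t. r t (Suc n) - r t n - slope n * r t 1) \<longlongrightarrow> 0) F" for n
  proof (induction n)
    case 0
    show ?case by (simp add: r0)
  next
    case (Suc n)
    let ?l = "q (n + 1) (n + 2)" and ?m = "q (n + 1) n"
    have l: "?l > 0" using birth_rate_pos[of "n + 1"] by simp
    have "((\<lambda>t. gen (n + 1) (r t) / ?l + ?m / ?l * (r t (Suc n) - r t n - slope n * r t 1)) \<longlongrightarrow>
        0 / ?l + ?m / ?l * 0) F"
      using l by (intro tendsto_intros gen Suc.IH) auto
    moreover have "gen (n + 1) (r t) / ?l + ?m / ?l * (r t (Suc n) - r t n - slope n * r t 1) =
        r t (Suc (Suc n)) - r t (Suc n) - slope (Suc n) * r t 1" for t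
      using l by (subst gen_flux) (simp_all add: field_simps)
    ultimately show ?case by simp
  qed
  show ?thesis
  proof (induction j)
    case 0
    show ?case by (simp add: r0)
  next
    case (Suc j)
    from tendsto_add[OF Suc.IH step[of j]] show ?case by (simp add: natural_scale_Suc algebra_simps)
  qed
qed

lemma harmonic_unique:
  assumes "v 0 = 0" "\<And>j. j \<ge> 1 \<Longrightarrow> gen j v = 0"
  shows "v j = natural_scale j * v 1"
  using approximately_harmonic_limit[of "\<lambda>_. v" sequentially j] assms by (simp add: LIMSEQ_const_iff)

text \<open>The truncations \<open>f N\<close> of the series for the semigroup applied to
  \<open>\<gamma>\<close> satisfy the backward equation, which is integrated over
  \<open>{0..1}\<close>. As \<open>N\<close> grows, the increment \<open>f N 1 j - f N 0 j\<close>
  tends to \<open>\<gamma> j - \<gamma> j = 0\<close>, while by dominated convergence the integral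
  tends to that of the constant \<open>gen j ?g\<close>. Resetting the value at 0 is harmless since
  harmonicity ignores it, and \<open>gen 1\<close> needs it to be 0.\<close>

lemma killed_harmonic_gen_zero:
  assumes h: "killed_harmonic P X \<gamma>" and j: "j \<ge> 1"
  shows "gen j (\<gamma>(0 := 0)) = 0"
proof -
  let ?g = "\<gamma>(0 := 0)"
  have g0: "0 \<le> ?g k" for k using h by (simp add: killed_harmonic_def)
  define f where "f N t l = (\<Sum>k<N. killed {k} t l * ?g k)" for N t l
  have sums: "(\<lambda>k. killed {k} t l * ?g k) sums ?g l" if "0 \<le> t" for t l
  proof (cases "l = 0")
    case True
    thus ?thesis using killed_start_0[OF that] by simp
  next
    case False
    hence "((\<lambda>k. killed {k} t l * \<gamma> k) has_sum \<gamma> l) {1..}"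
      using h that by (simp add: killed_harmonic_def killed_transition_def killed_def)
    also have "?this \<longleftrightarrow> ((\<lambda>k. killed {k} t l * ?g k) has_sum ?g l) UNIV"
      unfolding fun_upd_other[OF False] by (intro has_sum_cong_neutral) auto
    finally show ?thesis by (rule has_sum_imp_sums)
  qed
  have flim: "(\<lambda>N. f N t l) \<longlonglongrightarrow> ?g l" if "0 \<le> t" for t l
    using sums[OF that, of l] unfolding f_def sums_def .
  have fge: "0 \<le> f N t l" for N t l unfolding f_def by (intro sum_nonneg mult_nonneg_nonneg g0) simp
  have fle: "f N t l \<le> ?g l" if "0 \<le> t" for N t l
    unfolding f_def using sums[OF that, of l] g0
    by (intro sum_le_suminf[of _ "{..<N}", THEN order_trans]) (auto simp: sums_iff)
  have fgen: "gen l (f N t) = (\<Sum>k<N. gen l (killed {k} t) * ?g k)" for N t l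
    unfolding f_def gen_def by (simp add: sum_distrib_left sum_distrib_right sum.distrib algebra_simps)
  have int: "((\<lambda>t. gen j (f N t)) has_integral f N 1 j - f N 0 j) {0..1}" for N
  proof (rule fundamental_theorem_of_calculus)
    fix t :: real assume t: "t \<in> {0..1}"
    have "((\<lambda>t. f N t j) has_real_derivative gen j (f N t)) (at t within {0..})"
      unfolding fgen unfolding f_def
      by (intro DERIV_sum DERIV_cmult_right backward_equation) (use t j in auto)
    hence "((\<lambda>t. f N t j) has_real_derivative gen j (f N t)) (at t within {0..1})"
      by (rule DERIV_subset) auto
    thus "((\<lambda>t. f N t j) has_vector_derivative gen j (f N t)) (at t within {0..1})"
      by (simp add: has_real_derivative_iff_has_vector_derivative)
  qed simp
  \<comment> \<open>Each truncation lies between 0 and \<open>?g\<close>, and the generator reads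
    only three states, so one constant dominates for all \<open>N\<close> and
    \<open>t\<close>.\<close>
  define B where "B = \<bar>q j (j - 1)\<bar> * ?g (j - 1) + \<bar>q j j\<bar> * ?g j + \<bar>q j (j + 1)\<bar> * ?g (j + 1)"
  have bd: "norm (gen j (f N t)) \<le> B" if "0 \<le> t" for N t
  proof -
    have b: "\<bar>a * f N t l\<bar> \<le> \<bar>a\<bar> * ?g l" for a l
      using mult_left_mono[OF fle[OF that, of N l] abs_ge_zero[of a]]
      unfolding abs_mult abs_of_nonneg[OF fge] .
    from b[of "q j (j - 1)" "j - 1"] b[of "q j j" j] b[of "q j (j + 1)" "j + 1"]
    show ?thesis unfolding gen_def B_def real_norm_def by linarith
  qed
  have lim: "(\<lambda>N. integral {0..1} (\<lambda>t. gen j (f N t))) \<longlonglongrightarrow> integral {0..1::real} (\<lambda>t. gen j ?g)"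
  proof (rule dominated_convergence(2))
    show "(\<lambda>t. gen j (f N t)) integrable_on {0..1}" for N using int by blast
    show "(\<lambda>t::real. B) integrable_on {0..1}" by (rule integrable_const_ivl)
    show "norm (gen j (f N t)) \<le> B" if "t \<in> {0..1}" for N t using bd that by simp
    show "(\<lambda>N. gen j (f N t)) \<longlonglongrightarrow> gen j ?g" if "t \<in> {0..1}" for t
      unfolding gen_def using that by (intro tendsto_intros flim) auto
  qed
  moreover have "integral {0..1} (\<lambda>t. gen j (f N t)) = f N 1 j - f N 0 j" for N
    using int by (rule integral_unique)
  moreover have "(\<lambda>N. f N 1 j - f N 0 j) \<longlonglongrightarrow> ?g j - ?g j"
    by (intro tendsto_diff flim) auto
  ultimately have "integral {0..1::real} (\<lambda>t. gen j ?g) = 0"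
    using LIMSEQ_unique by fastforce
  thus ?thesis by simp
qed

lemma killed_harmonic_eq_scale:
  assumes "killed_harmonic P X \<gamma>" "\<gamma> 1 = 1" "k \<ge> 1"
  shows "\<gamma> k = natural_scale k"
  using harmonic_unique[of "\<gamma>(0 := 0)" k] killed_harmonic_gen_zero[OF assms(1)] assms(2,3) by simp

section \<open>Survival probabilities compared with the natural scale\<close>

abbreviation "surv \<equiv> killed UNIV"

lemma surv_antimono:
  assumes "0 \<le> s" "s \<le> t"
  shows "surv t j \<le> surv s j"
proof -
  interpret prob_space "P j" by (rule prob_space_P)
  have "ennreal s \<le> ennreal t" using assms by (intro ennreal_leI)
  hence "{\<omega> \<in> space (P j). X t \<omega> \<in> UNIV \<and> ennreal t < hitting_time_0 X \<omega>} \<subseteq>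
      {\<omega> \<in> space (P j). X s \<omega> \<in> UNIV \<and> ennreal s < hitting_time_0 X \<omega>}"
    by (auto intro: le_less_trans)
  thus ?thesis unfolding killed_def using assms(1) by (intro finite_measure_mono killed_set)
qed

text \<open>By the backward equation this is the time derivative of a nonincreasing
  function.\<close>

lemma gen_surv_nonpos:
  assumes "0 < t" "j \<ge> 1"
  shows "gen j (surv t) \<le> 0"
proof -
  have "((\<lambda>t. - surv t j) has_real_derivative - gen j (surv t)) (at t)"
    using killed_DERIV[OF assms] by (rule DERIV_minus)
  moreover have "mono_on {0..} (\<lambda>t. - surv t j)"
    using surv_antimono by (auto simp: mono_on_def)
  ultimately have "- gen j (surv t) \<ge> 0"
    using assms(1) by (intro mono_on_imp_deriv_nonneg[of "{0..}"]) auto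
  thus ?thesis by simp
qed

text \<open>Survival probabilities are superharmonic, hence concave in the natural scale.\<close>

lemma surv_scale_step:
  assumes "0 < t"
  shows "surv t (Suc j) * natural_scale j \<le> surv t j * natural_scale (Suc j)"
proof -
  \<comment> \<open>Concavity in cross-multiplied form, since \<open>slope\<close> is only known to
    be nonnegative and cannot be divided by.\<close>
  have "natural_scale j * (surv t (Suc j) - surv t j) \<le> surv t j * slope j"
  proof (induction j)
    case 0
    show ?case by simp
  next
    case (Suc n)
    let ?l = "q (n + 1) (n + 2)" and ?m = "q (n + 1) n" and ?h = "surv t"
    have l: "?l > 0" using birth_rate_pos[of "n + 1"] by simp
    have m: "?m \<ge> 0" using q_nonneg[of "n + 1" n] by simp
    have "?l * (?h (Suc (Suc n)) - ?h (Suc n)) \<le> ?m * (?h (Suc n) - ?h n)"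
      using gen_surv_nonpos[OF assms, of "n + 1"] gen_flux[of "n + 1" ?h] by simp
    hence "natural_scale (Suc n) * (?l * (?h (Suc (Suc n)) - ?h (Suc n))) \<le> natural_scale (Suc n) * (?m * (?h (Suc n) - ?h n))"
      by (intro mult_left_mono natural_scale_nonneg)
    \<comment> \<open>Splitting \<open>natural_scale (Suc n)\<close> isolates the induction
      hypothesis as a nonpositive bracket; \<open>slope_flux\<close> then turns the death rate of
      the remainder into the birth rate.\<close>
    also have "\<dots> = ?m * (natural_scale n * (?h (Suc n) - ?h n) - ?h n * slope n) + ?m * slope n * ?h (Suc n)"
      by (simp add: natural_scale_Suc algebra_simps)
    also have "\<dots> \<le> ?m * slope n * ?h (Suc n)"
      using Suc.IH m by (simp add: mult_nonneg_nonpos)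
    also have "\<dots> = ?l * (?h (Suc n) * slope (Suc n))"
      by (simp only: mult.left_commute[of ?l] slope_flux) (simp only: mult_ac)
    finally have "?l * (natural_scale (Suc n) * (?h (Suc (Suc n)) - ?h (Suc n))) \<le> ?l * (?h (Suc n) * slope (Suc n))"
      by (simp add: algebra_simps)
    thus ?case using l by (simp only: mult_le_cancel_left_pos)
  qed
  thus ?thesis by (simp add: natural_scale_Suc algebra_simps)
qed

lemma surv_le_scale:
  assumes "0 < t" "1 \<le> i" "i \<le> k"
  shows "surv t k / natural_scale k \<le> surv t i / natural_scale i"
  using assms(3)
proof (induction k rule: dec_induct)
  case (step n)
  have "surv t (Suc n) / natural_scale (Suc n) \<le> surv t n / natural_scale n"
    using surv_scale_step[OF assms(1), of n] natural_scale_pos[of n] natural_scale_pos[of "Suc n"] step(1) assms(2)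
    by (simp add: field_simps)
  thus ?case using step.IH by linarith
qed simp

lemma killed_pos_obtain:
  assumes "j \<ge> 1" "k \<ge> 1"
  obtains s where "s > 0" "0 < killed {k} s j"
proof -
  obtain s where "s > 0" "0 < killed_transition P X s j k"
    using killed_irred assms unfolding killed_irreducible_def by blast
  thus ?thesis using that by (simp add: killed_transition_def killed_def)
qed

text \<open>Expand the decrement at \<open>j\<close> by the semigroup law at time \<open>s\<close>:
  all terms are nonnegative because survival decreases in time, and only the one through
  \<open>k\<close> is kept.\<close>

lemma surv_decrement_ge:
  assumes "0 \<le> s" "0 \<le> t" "0 \<le> a"
  shows "killed {k} s j * (surv t k - surv (t + a) k) \<le> surv (s + t) j - surv (s + (t + a)) j"
proof (rule sums_le[OF _ sums_single])
  have "(\<lambda>l. killed {l} s j * surv t l - killed {l} s j * surv (t + a) l) sums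
      (surv (s + t) j - surv (s + (t + a)) j)"
    using assms by (intro sums_diff killed_semigroup) auto
  thus "(\<lambda>l. killed {l} s j * (surv t l - surv (t + a) l)) sums (surv (s + t) j - surv (s + (t + a)) j)"
    by (simp only: right_diff_distrib)
  show "(if r = k then killed {r} s j * (surv t r - surv (t + a) r) else 0) \<le>
      killed {r} s j * (surv t r - surv (t + a) r)" for r
    using surv_antimono[of t "t + a" r] assms by simp
qed

section \<open>Ratio limits for a long-tailed starting state\<close>

context
  fixes i :: nat
  assumes i: "i \<ge> 1"
    and surv_pos: "\<And>t. 0 \<le> t \<Longrightarrow> 0 < surv t i"
    and long_tailed: "\<And>a. 0 \<le> a \<Longrightarrow> ((\<lambda>t. surv (t + a) i / surv t i) \<longlongrightarrow> 1) at_top"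
begin

text \<open>Every decrement of \<open>surv\<close> at \<open>k\<close> shows up, damped by a constant factor, as a later
  decrement at \<open>i\<close>; so long-tailedness at \<open>i\<close> controls all states.\<close>

lemma surv_decrement_small:
  assumes "0 \<le> a"
  shows "((\<lambda>t. (surv t k - surv (t + a) k) / surv t i) \<longlongrightarrow> 0) at_top"
proof (cases "k = 0")
  case True
  have "\<forall>\<^sub>F t in at_top. 0 = (surv t k - surv (t + a) k) / surv t i"
    using eventually_ge_at_top[of 0] by eventually_elim (use assms in \<open>simp add: True killed_start_0\<close>)
  thus ?thesis by (rule Lim_transform_eventually[OF tendsto_const])
next
  case False
  then obtain s where s: "s > 0" "0 < killed {k} s i" using killed_pos_obtain[of i k] i by auto
  let ?c = "killed {k} s i"
  have "((\<lambda>t. (1 - surv (t + (s + a)) i / surv t i) / ?c) \<longlongrightarrow> (1 - 1) / ?c) at_top"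
    using s assms by (intro tendsto_intros long_tailed) auto
  hence up: "((\<lambda>t. (1 - surv (t + (s + a)) i / surv t i) / ?c) \<longlongrightarrow> 0) at_top" by simp
  show ?thesis
  proof (rule tendsto_sandwich[OF _ _ tendsto_const up])
    show "\<forall>\<^sub>F t in at_top. 0 \<le> (surv t k - surv (t + a) k) / surv t i"
      using eventually_ge_at_top[of 0]
      by eventually_elim (use surv_antimono surv_pos assms in \<open>auto intro!: divide_nonneg_pos\<close>)
    show "\<forall>\<^sub>F t in at_top. (surv t k - surv (t + a) k) / surv t i \<le>
        (1 - surv (t + (s + a)) i / surv t i) / ?c"
      using eventually_ge_at_top[of 0]
    proof eventually_elim
      case (elim t)
      have "?c * (surv t k - surv (t + a) k) \<le> surv (s + t) i - surv (s + (t + a)) i"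
        using s elim assms by (intro surv_decrement_ge) auto
      \<comment> \<open>The time window is enlarged to begin at \<open>t\<close>, so that the bound
        is relative to \<open>surv t i\<close> and long-tailedness applies with shift
        \<open>s + a\<close>.\<close>
      also have "\<dots> \<le> surv t i - surv (t + (s + a)) i"
        using surv_antimono[of t "s + t" i] s elim by (simp add: add_ac)
      finally have "surv t k - surv (t + a) k \<le> (surv t i - surv (t + (s + a)) i) / ?c"
        using s by (simp only: pos_le_divide_eq mult.commute)
      hence "(surv t k - surv (t + a) k) / surv t i \<le> (surv t i - surv (t + (s + a)) i) / ?c / surv t i"
        using surv_pos[OF elim] by (intro divide_right_mono) auto
      also have "\<dots> = (1 - surv (t + (s + a)) i / surv t i) / ?c"
        using surv_pos[OF elim] by (simp add: diff_divide_distrib)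
      finally show ?case .
    qed
  qed
qed

text \<open>The mean value theorem yields some \<open>u\<close> between \<open>t\<close> and
  \<open>t + 1\<close> at which the generator equals a unit-time increment of \<open>surv\<close> at
  \<open>j\<close>. Moving from \<open>u\<close> back to \<open>t\<close> costs at most the rates
  times unit-time decrements at \<open>j\<close> and its neighbours, and all these are negligible
  relative to \<open>surv t i\<close>.\<close>

lemma ratio_generator_limit:
  assumes j: "j \<ge> 1"
  shows "((\<lambda>t. gen j (\<lambda>k. surv t k / surv t i)) \<longlongrightarrow> 0) at_top"
proof -
  let ?d = "\<lambda>t k. (surv t k - surv (t + 1) k) / surv t i"
  let ?b = "\<lambda>t. \<bar>q j (j - 1)\<bar> * ?d t (j - 1) + \<bar>q j j\<bar> * ?d t j + \<bar>q j (j + 1)\<bar> * ?d t (j + 1) + ?d t j"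
  have "(?b \<longlongrightarrow> \<bar>q j (j - 1)\<bar> * 0 + \<bar>q j j\<bar> * 0 + \<bar>q j (j + 1)\<bar> * 0 + 0) at_top"
    by (intro tendsto_intros surv_decrement_small) auto
  hence b: "(?b \<longlongrightarrow> 0) at_top" by simp
  have "\<forall>\<^sub>F t in at_top. norm (gen j (\<lambda>k. surv t k / surv t i)) \<le> ?b t"
    using eventually_gt_at_top[of 0]
  proof eventually_elim
    case (elim t)
    have "\<exists>u. t < u \<and> u < t + 1 \<and> surv (t + 1) j - surv t j = (t + 1 - t) * gen j (surv u)"
      using elim j by (intro MVT2 killed_DERIV) auto
    then obtain u where u: "t < u" "u < t + 1" "gen j (surv u) = surv (t + 1) j - surv t j" by auto
    have e: "\<bar>a * (surv t k - surv u k)\<bar> \<le> \<bar>a\<bar> * (surv t k - surv (t + 1) k)" for a k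
    proof -
      have "surv u k \<le> surv t k" "surv (t + 1) k \<le> surv u k" using u elim by (auto intro!: surv_antimono)
      hence "\<bar>a\<bar> * \<bar>surv t k - surv u k\<bar> \<le> \<bar>a\<bar> * (surv t k - surv (t + 1) k)"
        by (intro mult_left_mono) auto
      thus ?thesis by (simp only: abs_mult)
    qed
    have tri: "\<bar>x1 + x2 + x3 + x4\<bar> \<le> \<bar>x1\<bar> + \<bar>x2\<bar> + \<bar>x3\<bar> + \<bar>x4\<bar>" for x1 x2 x3 x4 :: real
      by linarith
    have "gen j (surv t) = q j (j - 1) * (surv t (j - 1) - surv u (j - 1)) + q j j * (surv t j - surv u j)
      + q j (j + 1) * (surv t (j + 1) - surv u (j + 1)) + gen j (surv u)"
      unfolding gen_def by (simp add: algebra_simps)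
    hence "\<bar>gen j (surv t)\<bar> \<le> \<bar>q j (j - 1) * (surv t (j - 1) - surv u (j - 1))\<bar> + \<bar>q j j * (surv t j - surv u j)\<bar>
      + \<bar>q j (j + 1) * (surv t (j + 1) - surv u (j + 1))\<bar> + \<bar>gen j (surv u)\<bar>"
      by (simp only: tri)
    also have "\<dots> \<le> \<bar>q j (j - 1)\<bar> * (surv t (j - 1) - surv (t + 1) (j - 1)) +
       \<bar>q j j\<bar> * (surv t j - surv (t + 1) j) + \<bar>q j (j + 1)\<bar> * (surv t (j + 1) - surv (t + 1) (j + 1)) +
       (surv t j - surv (t + 1) j)" (is "_ \<le> ?B")
    proof (intro add_mono e)
      show "\<bar>gen j (surv u)\<bar> \<le> surv t j - surv (t + 1) j"
        unfolding u(3) using surv_antimono[of t "t + 1" j] elim by simp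
    qed
    finally have "\<bar>gen j (surv t)\<bar> \<le> ?B" .
    hence "\<bar>gen j (surv t)\<bar> / surv t i \<le> ?B / surv t i"
      using surv_pos[of t] elim by (intro divide_right_mono) auto
    also have "?B / surv t i = ?b t" by (simp add: add_divide_distrib)
    finally have "\<bar>gen j (surv t)\<bar> / surv t i \<le> ?b t" .
    moreover have "gen j (\<lambda>k. surv t k / surv t i) = gen j (surv t) / surv t i"
      by (simp add: gen_def add_divide_distrib)
    ultimately show ?case using surv_pos[of t] elim by simp
  qed
  thus ?thesis by (rule Lim_null_comparison[OF _ b])
qed

text \<open>Approximate harmonicity determines the ratios only up to the factor
  \<open>r t 1\<close>. At \<open>j = i\<close> the ratio is identically 1, which forces
  \<open>r t 1\<close> to tend to \<open>1 / natural_scale i\<close>.\<close>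

lemma ratio_limit: "((\<lambda>t. surv t j / surv t i) \<longlongrightarrow> natural_scale j / natural_scale i) at_top"
proof -
  \<comment> \<open>The value 0 at negative times makes \<open>r t 0 = 0\<close> hold for every
    \<open>t\<close>, as \<open>approximately_harmonic_limit\<close> demands.\<close>
  define r where "r t k = (if 0 \<le> t then surv t k / surv t i else 0)" for t :: real and k
  have ev: "\<forall>\<^sub>F t in at_top. r t = (\<lambda>k. surv t k / surv t i)"
    using eventually_ge_at_top[of 0] by eventually_elim (simp add: r_def fun_eq_iff)
  have lim: "((\<lambda>t. r t k - natural_scale k * r t 1) \<longlongrightarrow> 0) at_top" for k
  proof (rule approximately_harmonic_limit)
    show "r t 0 = 0" for t by (simp add: r_def killed_start_0)
    show "((\<lambda>t. gen l (r t)) \<longlongrightarrow> 0) at_top" if "l \<ge> 1" for l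
      by (rule Lim_transform_eventually[OF ratio_generator_limit[OF that]])
        (use ev in eventually_elim, simp)
  qed
  have "((\<lambda>t. 1 - natural_scale i * r t 1) \<longlongrightarrow> 0) at_top"
    by (rule Lim_transform_eventually[OF lim[of i]])
      (use eventually_ge_at_top[of 0] in eventually_elim, use surv_pos in \<open>force simp: r_def\<close>)
  hence "((\<lambda>t. (1 - (1 - natural_scale i * r t 1)) / natural_scale i) \<longlongrightarrow> (1 - 0) / natural_scale i) at_top"
    using natural_scale_pos[OF i] by (intro tendsto_intros) auto
  hence "((\<lambda>t. r t 1) \<longlongrightarrow> 1 / natural_scale i) at_top" using natural_scale_pos[OF i] by simp
  hence "((\<lambda>t. (r t j - natural_scale j * r t 1) + natural_scale j * r t 1) \<longlongrightarrow> 0 + natural_scale j * (1 / natural_scale i)) at_top"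
    by (intro tendsto_intros lim)
  hence "((\<lambda>t. r t j) \<longlongrightarrow> natural_scale j / natural_scale i) at_top" by simp
  thus ?thesis
    by (rule Lim_transform_eventually) (use ev in eventually_elim, simp)
qed

lemma shifted_ratio_limit:
  assumes "0 \<le> s"
  shows "((\<lambda>t. surv (s + t) j / surv t i) \<longlongrightarrow> natural_scale j / natural_scale i) at_top"
  using tendsto_diff[OF ratio_limit[of j] surv_decrement_small[OF assms, of j]]
  by (simp add: diff_divide_distrib add.commute)

text \<open>Divide \<open>surv (s + t) j = (\<Sum>l. killed {l} s j * surv t l)\<close> by \<open>surv t i\<close> and let \<open>t\<close> tend to
  infinity: Fatou gives superharmonicity of \<open>natural_scale\<close>, and \<open>surv_le_scale\<close> then provides the
  domination for equality.\<close>

lemma scale_killed_sums: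
  assumes s: "0 \<le> s"
  shows "(\<lambda>l. killed {l} s j * natural_scale l) sums natural_scale j"
proof -
  let ?w = "\<lambda>l. killed {l} s j"
  let ?r = "\<lambda>t l. surv t l / surv t i"
  have ratio_sums: "(\<lambda>l. ?w l * ?r t l) sums (surv (s + t) j / surv t i)" if "0 \<le> t" for t
    using sums_divide[OF killed_semigroup[OF s that, of j UNIV], of "surv t i"] by simp
  have Fatou: "(\<Sum>l<L. ?w l * (natural_scale l / natural_scale i)) \<le> natural_scale j / natural_scale i" for L
  proof (rule tendsto_le[OF _ shifted_ratio_limit[OF s]])
    show "((\<lambda>t. \<Sum>l<L. ?w l * ?r t l) \<longlongrightarrow> (\<Sum>l<L. ?w l * (natural_scale l / natural_scale i))) at_top"
      by (intro tendsto_intros ratio_limit)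
    show "\<forall>\<^sub>F t in at_top. (\<Sum>l<L. ?w l * ?r t l) \<le> surv (s + t) j / surv t i"
      using eventually_ge_at_top[of 0]
    proof eventually_elim
      case (elim t)
      show ?case using ratio_sums[OF elim]
        by (intro sum_le_suminf[of _ "{..<L}", THEN order_trans]) (auto simp: sums_iff)
    qed
  qed simp
  have nn: "0 \<le> ?w l * (natural_scale l / natural_scale i)" for l using natural_scale_nonneg by simp
  have summ: "summable (\<lambda>l. ?w l * (natural_scale l / natural_scale i))"
    by (rule summableI_nonneg_bounded[OF nn Fatou])
  define \<Sigma> where "\<Sigma> = (\<Sum>l. ?w l * (natural_scale l / natural_scale i))"
  have sums: "(\<lambda>l. ?w l * (natural_scale l / natural_scale i)) sums \<Sigma>"
    using summ by (simp add: \<Sigma>_def summable_sums)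
  have le: "\<Sigma> \<le> natural_scale j / natural_scale i"
    unfolding \<Sigma>_def using summ Fatou by (rule suminf_le_const)
  have ge: "natural_scale j / natural_scale i \<le> \<Sigma>"
  proof (rule tendsto_le[OF _ _ shifted_ratio_limit[OF s]])
    \<comment> \<open>For \<open>l \<ge> i\<close>, \<open>surv_le_scale\<close> bounds each term by
      its own limit, so the full limit sum dominates there; only the finitely many states below
      \<open>i\<close> need a correction, and it tends to 0.\<close>
    let ?g = "\<lambda>t. (\<Sum>l<i. ?w l * ?r t l - ?w l * (natural_scale l / natural_scale i)) + \<Sigma>"
    have "(?g \<longlongrightarrow> (\<Sum>l<i. ?w l * (natural_scale l / natural_scale i) - ?w l * (natural_scale l / natural_scale i)) + \<Sigma>) at_top"
      by (intro tendsto_intros ratio_limit)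
    thus "(?g \<longlongrightarrow> \<Sigma>) at_top" by simp
    show "\<forall>\<^sub>F t in at_top. surv (s + t) j / surv t i \<le> ?g t"
      using eventually_gt_at_top[of 0]
    proof eventually_elim
      case (elim t)
      let ?d = "\<lambda>l. ?w l * ?r t l - ?w l * (natural_scale l / natural_scale i)"
      have "(\<lambda>l. (if l \<in> {..<i} then ?d l else 0) + ?w l * (natural_scale l / natural_scale i)) sums ?g t"
        by (intro sums_add sums sums_If_finite_set) auto
      moreover have "?w l * ?r t l \<le> (if l \<in> {..<i} then ?d l else 0) + ?w l * (natural_scale l / natural_scale i)" for l
      proof (cases "l < i")
        case False
        have "surv t l / natural_scale l \<le> surv t i / natural_scale i"
          using False i elim by (intro surv_le_scale) auto
        hence "?r t l \<le> natural_scale l / natural_scale i"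
          using surv_pos[of t] natural_scale_pos[of l] natural_scale_pos[OF i] False i elim by (simp add: field_simps)
        hence "?w l * ?r t l \<le> ?w l * (natural_scale l / natural_scale i)" by (intro mult_left_mono) auto
        thus ?thesis using False by simp
      qed simp
      ultimately show ?case using elim by (intro sums_le[OF _ ratio_sums]) auto
    qed
  qed simp
  have "\<Sigma> * natural_scale i = natural_scale j" using le ge natural_scale_pos[OF i] by simp
  moreover have "(\<lambda>l. ?w l * (natural_scale l / natural_scale i) * natural_scale i) sums (\<Sigma> * natural_scale i)"
    using sums by (rule sums_mult2)
  ultimately show ?thesis using natural_scale_pos[OF i] by simp
qed

lemma killed_harmonic_scale: "killed_harmonic P X natural_scale"
  unfolding killed_harmonic_def
proof (intro conjI allI impI)
  show "0 \<le> natural_scale k" for k by (rule natural_scale_nonneg)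
  fix t :: real and j :: nat
  assume t: "0 \<le> t" and j: "1 \<le> j"
  have "((\<lambda>l. killed {l} t j * natural_scale l) has_sum natural_scale j) UNIV"
    by (rule sums_nonneg_imp_has_sum[OF scale_killed_sums[OF t]]) (simp add: natural_scale_nonneg)
  also have "?this \<longleftrightarrow> ((\<lambda>l. killed_transition P X t j l * natural_scale l) has_sum natural_scale j) {1..}"
    by (intro has_sum_cong_neutral) (auto simp: killed_transition_def killed_def Suc_le_eq)
  finally show "((\<lambda>l. killed_transition P X t j l * natural_scale l) has_sum natural_scale j) {1..}" .
qed

end

end

theorem theorem3p10:
  fixes P :: "nat \<Rightarrow> 'a measure" and X :: "real \<Rightarrow> 'a \<Rightarrow> nat"
    and q :: "nat \<Rightarrow> nat \<Rightarrow> real" and i :: nat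
  assumes chain: "markov_chain P X q"
    and irreducible: "irreducible_chain P X"
    and nonexplosive: "non_explosive P X"
    and killed_irreducible: "killed_irreducible P X"
    and recurrent: "recurrent P X"
    and birth_death: "\<And>k j. k \<ge> 1 \<Longrightarrow> \<bar>int k - int j\<bar> > 1 \<Longrightarrow> q k j = 0"
    and i: "i \<ge> 1"
    and subexp: "subexponential (P i) (hitting_time_0 X)"
  shows "\<exists>\<beta>. killed_harmonic P X \<beta> \<and> \<beta> 1 = 1 \<and>
    (\<forall>\<gamma>. killed_harmonic P X \<gamma> \<and> \<gamma> 1 = 1 \<longrightarrow> (\<forall>k\<ge>1. \<gamma> k = \<beta> k)) \<and>
    (\<forall>j\<ge>1. hitting_tail P X j \<sim>[at_top] (\<lambda>t. \<beta> j / \<beta> i * hitting_tail P X i t))"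
proof -
  interpret killed_birth_death P X q
    using chain birth_death killed_irreducible
    unfolding killed_birth_death_def killed_birth_death_axioms_def by blast
  have surv: "hitting_tail P X j t = surv t j" for j t
    by (simp add: hitting_tail_def killed_def)
  \<comment> \<open>Rewritten in terms of \<open>surv\<close>, the two conclusions are the
    positivity and long-tail assumptions under which the ratio limits were proved.\<close>
  note long = subexponential_long_tailed[OF prob_space_P subexp, folded hitting_tail_def, unfolded surv]
  show ?thesis
  proof (intro exI conjI allI impI)
    show "killed_harmonic P X natural_scale"
      by (rule killed_harmonic_scale[OF i long])
    show "natural_scale 1 = 1" by simp
    show "\<gamma> k = natural_scale k" if "killed_harmonic P X \<gamma> \<and> \<gamma> 1 = 1" "k \<ge> 1" for \<gamma> k
      using that killed_harmonic_eq_scale by blast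
    show "hitting_tail P X j \<sim>[at_top] (\<lambda>t. natural_scale j / natural_scale i * hitting_tail P X i t)"
      if "j \<ge> 1" for j
    proof (rule asymp_equivI')
      let ?c = "natural_scale j / natural_scale i"
      have c: "?c \<noteq> 0" using natural_scale_pos[OF that] natural_scale_pos[OF i] by simp
      have "((\<lambda>t. surv t j / surv t i / ?c) \<longlongrightarrow> ?c / ?c) at_top"
        using c by (intro tendsto_divide tendsto_const ratio_limit[OF i long])
      thus "((\<lambda>t. hitting_tail P X j t / (?c * hitting_tail P X i t)) \<longlongrightarrow> 1) at_top"
        using c by (simp add: surv mult.commute)
    qed
  qed
qed

end
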